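(* Let $d\ge 1$ be an integer and let $T_j:H(\mathbb{C}^d)\rightarrow H(\mathbb{C}^d)$, $j=1,\dots,d$, be continuous linear operators such that 1. $\bigcap_{j=1}^d\ker T_j\neq\{0\}$; 2. there are constants $a_1,\dots,a_d\in\mathbb{C}\setminus\{0\}$ such that $$\Bigl[T_j,\frac{\partial}{\partial z_k}\Bigr]=\delta_{jk}a_jI,\qquad j,k=1,\dots,d,$$ where $\delta_{jk}$ is Kronecker's delta and $I$ is the identity operator on $H(\mathbb{C}^d)$. Then each of the operators $T_j$, $j=1,\dots,d$, is frequently hypercyclic.
   Context: $H(\mathbb{C}^d)$ is the space of all entire functions on $\mathbb{C}^d$ (variables $z=(z_1,\dots,z_d)$) with the topology of uniform convergence on compact subsets. For linear operators $A,B$ on $H(\mathbb{C}^d)$, $[A,B]=AB-BA$ is the commutator. $\mathbb{N}_0$ is the set of non-negative integers. The lower density of a set $A\subset\mathbb{N}_0$ is $\underline{\mathrm{dens}}(A)=\liminf_{N\to\infty}\frac{\#\{n\in A: n\le N\}}{N}$, where $\#$ denotes cardinality. A continuous linear operator $T$ on a topological vector space $X$ is called frequently hypercyclic if there exists $x\in X$ such that, for every non-empty open subset $U$ of $X$, $\underline{\mathrm{dens}}\{n\in\mathbb{N}_0: T^nx\in U\}>0$. *)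

theory Defs
  imports "HOL-Analysis.Analysis"
begin

text \<open>The index type \<open>'d\<close> plays the role of \<open>{1,\<dots>,d}\<close>, so \<open>d = CARD('d) \<ge> 1\<close>.
  Holomorphy is complex Frechet differentiability: the real derivative at each point exists
  and is \<open>\<complex>\<close>-linear.\<close>

definition entire :: "(complex ^ 'd::finite \<Rightarrow> complex) set" where
  "entire = {f. \<forall>z. \<exists>f'. (f has_derivative f') (at z) \<and> Vector_Spaces.linear (*s) (*) f'}"

definition pderiv_at :: "'d::finite \<Rightarrow> (complex ^ 'd \<Rightarrow> complex) \<Rightarrow> (complex ^ 'd \<Rightarrow> complex)" where
  "pderiv_at k f = (\<lambda>z. deriv (\<lambda>w. f (\<chi> i. if i = k then w else z $ i)) (z $ k))"

text \<open>A set is open iff around each of its points \<open>f\<close> it contains a basic neighbourhood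
  \<open>{g. sup\<^sub>K |g - f| < e}\<close>. A single compact set suffices because finite unions of compact sets
  are compact.\<close>

definition entire_open :: "(complex ^ 'd::finite \<Rightarrow> complex) set \<Rightarrow> bool" where
  "entire_open U \<longleftrightarrow> U \<subseteq> entire \<and>
     (\<forall>f\<in>U. \<exists>K e. compact K \<and> e > 0 \<and>
        {g \<in> entire. \<forall>z\<in>K. cmod (g z - f z) < e} \<subseteq> U)"

definition entire_topology :: "(complex ^ 'd::finite \<Rightarrow> complex) topology" where
  "entire_topology = topology entire_open"

lemma entire_openI:
  assumes "U \<subseteq> entire"
    and "\<And>f. f \<in> U \<Longrightarrow> \<exists>K e. compact K \<and> e > 0 \<and> {g \<in> entire. \<forall>z\<in>K. cmod (g z - f z) < e} \<subseteq> U"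
  shows "entire_open U"
  using assms unfolding entire_open_def by simp

lemma entire_openE:
  assumes "entire_open U" "f \<in> U"
  obtains K e where "compact K" "e > 0" "{g \<in> entire. \<forall>z\<in>K. cmod (g z - f z) < e} \<subseteq> U"
proof -
  have "\<exists>K e. compact K \<and> e > 0 \<and> {g \<in> entire. \<forall>z\<in>K. cmod (g z - f z) < e} \<subseteq> U"
    using assms unfolding entire_open_def by simp
  then show thesis by (elim exE conjE) (rule that)
qed

lemma entire_open_subset: "entire_open U \<Longrightarrow> U \<subseteq> entire"
  unfolding entire_open_def by (rule conjunct1)

lemma istopology_entire_open: "istopology (entire_open :: (complex ^ 'd::finite \<Rightarrow> complex) set \<Rightarrow> bool)"
  unfolding istopology_def
proof (intro conjI allI impI)
  fix S T :: "(complex ^ 'd \<Rightarrow> complex) set"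
  assume S: "entire_open S" and T: "entire_open T"
  show "entire_open (S \<inter> T)"
  proof (rule entire_openI)
    show "S \<inter> T \<subseteq> entire" using entire_open_subset[OF S] by (rule le_infI1)
    fix f assume f: "f \<in> S \<inter> T"
    obtain K e where 1: "compact K" "e > 0" "{g \<in> entire. \<forall>z\<in>K. cmod (g z - f z) < e} \<subseteq> S"
      by (rule entire_openE[OF S IntD1[OF f]])
    obtain L e' where 2: "compact L" "e' > 0" "{g \<in> entire. \<forall>z\<in>L. cmod (g z - f z) < e'} \<subseteq> T"
      by (rule entire_openE[OF T IntD2[OF f]])
    have "{g \<in> entire. \<forall>z\<in>K \<union> L. cmod (g z - f z) < min e e'} \<subseteq> S \<inter> T"
    proof (intro subsetI IntI)
      fix g assume g: "g \<in> {g \<in> entire. \<forall>z\<in>K \<union> L. cmod (g z - f z) < min e e'}"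
      show "g \<in> S" by (rule subsetD[OF 1(3)]) (use g in simp)
      show "g \<in> T" by (rule subsetD[OF 2(3)]) (use g in simp)
    qed
    moreover have "compact (K \<union> L)" using 1(1) 2(1) by (rule compact_Un)
    moreover have "min e e' > 0" using 1(2) 2(2) by simp
    ultimately show "\<exists>K e. compact K \<and> e > 0 \<and>
        {g \<in> entire. \<forall>z\<in>K. cmod (g z - f z) < e} \<subseteq> S \<inter> T" by (intro exI conjI)
  qed
next
  fix \<K> :: "(complex ^ 'd \<Rightarrow> complex) set set"
  assume *: "\<forall>U\<in>\<K>. entire_open U"
  show "entire_open (\<Union>\<K>)"
  proof (rule entire_openI)
    show "\<Union>\<K> \<subseteq> entire" by (rule Union_least) (rule entire_open_subset[OF bspec[OF *]])
    fix f assume "f \<in> \<Union>\<K>"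
    then obtain U where U: "U \<in> \<K>" "f \<in> U" by (rule UnionE)
    obtain K e where 1: "compact K" "e > 0" "{g \<in> entire. \<forall>z\<in>K. cmod (g z - f z) < e} \<subseteq> U"
      by (rule entire_openE[OF bspec[OF * U(1)] U(2)])
    have "{g \<in> entire. \<forall>z\<in>K. cmod (g z - f z) < e} \<subseteq> \<Union>\<K>"
      by (rule order_trans[OF 1(3) Union_upper[OF U(1)]])
    with 1(1,2) show "\<exists>K e. compact K \<and> e > 0 \<and>
        {g \<in> entire. \<forall>z\<in>K. cmod (g z - f z) < e} \<subseteq> \<Union>\<K>" by (intro exI conjI)
  qed
qed

lemma openin_entire_topology: "openin entire_topology U \<longleftrightarrow> entire_open U"
  by (simp only: entire_topology_def topology_inverse'[OF istopology_entire_open])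

lemma topspace_entire_topology:
  "topspace entire_topology = (entire :: (complex ^ 'd::finite \<Rightarrow> complex) set)"
proof
  show "topspace entire_topology \<subseteq> (entire :: (complex ^ 'd \<Rightarrow> complex) set)"
    by (rule entire_open_subset) (simp only: openin_entire_topology[symmetric] openin_topspace)
  have "entire_open (entire :: (complex ^ 'd \<Rightarrow> complex) set)"
  proof (rule entire_openI)
    fix f :: "complex ^ 'd \<Rightarrow> complex"
    have "compact ({} :: (complex ^ 'd) set)" "(0::real) < 1"
      "{g \<in> entire. \<forall>z\<in>{}. cmod (g z - f z) < 1} \<subseteq> entire" by simp_all
    then show "\<exists>K e. compact K \<and> e > 0 \<and> {g \<in> entire. \<forall>z\<in>K. cmod (g z - f z) < e} \<subseteq> entire"
      by (intro exI conjI)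
  qed (rule subset_refl)
  then show "(entire :: (complex ^ 'd \<Rightarrow> complex) set) \<subseteq> topspace entire_topology"
    by (simp only: openin_entire_topology[symmetric] openin_subset)
qed

text \<open>Operators on \<open>H(\<complex>\<^sup>d)\<close> are HOL functions of which only the restriction to \<^const>\<open>entire\<close> matters;
  \<^const>\<open>continuous_map\<close> includes that \<^const>\<open>entire\<close> is mapped into itself.\<close>

definition continuous_linear_operator ::
    "((complex ^ 'd::finite \<Rightarrow> complex) \<Rightarrow> (complex ^ 'd \<Rightarrow> complex)) \<Rightarrow> bool" where
  "continuous_linear_operator T \<longleftrightarrow>
     continuous_map entire_topology entire_topology T \<and>
     (\<forall>f\<in>entire. \<forall>g\<in>entire. T (\<lambda>z. f z + g z) = (\<lambda>z. T f z + T g z)) \<and>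
     (\<forall>c. \<forall>f\<in>entire. T (\<lambda>z. c * f z) = (\<lambda>z. c * T f z))"

definition op_kernel ::
    "((complex ^ 'd::finite \<Rightarrow> complex) \<Rightarrow> (complex ^ 'd \<Rightarrow> complex)) \<Rightarrow> (complex ^ 'd \<Rightarrow> complex) set" where
  "op_kernel T = {f \<in> entire. T f = (\<lambda>z. 0)}"

definition commutator ::
    "(('a \<Rightarrow> complex) \<Rightarrow> ('a \<Rightarrow> complex)) \<Rightarrow> (('a \<Rightarrow> complex) \<Rightarrow> ('a \<Rightarrow> complex))
      \<Rightarrow> ('a \<Rightarrow> complex) \<Rightarrow> ('a \<Rightarrow> complex)" where
  "commutator A B f = (\<lambda>z. A (B f) z - B (A f) z)"

text \<open>The value at \<open>N = 0\<close> (division by zero) does not affect the limit inferior.\<close>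

definition lower_density :: "nat set \<Rightarrow> ereal" where
  "lower_density A = liminf (\<lambda>N. ereal (real (card {n \<in> A. n \<le> N}) / real N))"

definition frequently_hypercyclic :: "'a topology \<Rightarrow> ('a \<Rightarrow> 'a) \<Rightarrow> bool" where
  "frequently_hypercyclic X T \<longleftrightarrow>
     (\<exists>x\<in>topspace X. \<forall>U. openin X U \<and> U \<noteq> {} \<longrightarrow> lower_density {n. (T ^^ n) x \<in> U} > 0)"

end

theory Submission
  imports Defs "HOL-Complex_Analysis.Cauchy_Integral_Formula"
begin

text \<open>
  Let \<open>f \<noteq> 0\<close> lie in all the kernels and let \<open>M\<close> be the closed span of the partial derivatives of all
  orders of \<open>f\<close>. The commutation relations make \<open>M\<close> invariant under every \<open>T\<^sub>j\<close>. The operator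
  \<open>S = T\<^sub>j + a\<^sub>j z\<^sub>j\<close> commutes with all \<open>\<partial>/\<partial>z\<^sub>k\<close>, hence with translations, and expanding
  \<open>(S g)(z) = (S (g(\<cdot> + z)))(0)\<close> in a Taylor series shows that \<open>S\<close> preserves closed subspaces invariant under
  differentiation. So \<open>M\<close> is invariant under multiplication by \<open>z\<^sub>j\<close> as well. Choosing \<open>u\<close> with
  \<open>f(u) \<noteq> 0\<close>, the Taylor expansion \<open>f(u) = \<Sum>\<^sub>n ((u - z) \<cdot> \<partial>)\<^sup>n f(z) / n!\<close>, read as an identity between
  functions of \<open>z\<close>, puts the constants into \<open>M\<close>; hence \<open>M\<close> contains the polynomials and is everything.

  Each derivative of \<open>f\<close> can be written \<open>\<partial>\<^sub>j\<^sup>m g\<close> with \<open>T\<^sub>j g = 0\<close>. As \<open>T\<^sub>j \<partial>\<^sub>j\<^sup>n g = n a\<^sub>j \<partial>\<^sub>j\<^sup>n\<^sup>-\<^sup>1 g\<close>, it is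
  killed by a power of \<open>T\<^sub>j\<close> and has the backward orbit \<open>m! / (a\<^sub>j\<^sup>q (m + q)!) \<partial>\<^sub>j\<^sup>m\<^sup>+\<^sup>q g\<close>, which decays faster
  than any geometric sequence by Cauchy's estimates. A frequently hypercyclic vector is the sum of terms of
  such backward orbits, the orbit of index \<open>h(l)\<close> being used at the \<open>n\<close>-th chosen time whenever
  \<open>2\<^sup>l\<close> is the exact power of \<open>2\<close> dividing \<open>n\<close>.
\<close>

section \<open>Directional derivatives of entire functions\<close>

text \<open>Arbitrary directions are allowed because later expansions use directions that are
  themselves variables, such as \<open>ddir x\<close> or \<open>ddir (u - z)\<close>.\<close>

definition ddir :: "complex ^ 'd::finite \<Rightarrow> (complex ^ 'd \<Rightarrow> complex) \<Rightarrow> (complex ^ 'd \<Rightarrow> complex)" where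
  "ddir v f = (\<lambda>z. deriv (\<lambda>t. f (z + t *s v)) 0)"

lemma norm_vector_smult: "norm (c *s v) = cmod c * norm v" for v :: "complex ^ 'd::finite"
  by (simp add: norm_vec_def norm_mult L2_set_right_distrib)

lemma vector_smult_linear_iff:
  "Vector_Spaces.linear (*s) (*) (f :: complex ^ 'd::finite \<Rightarrow> complex) \<longleftrightarrow>
     (\<forall>x y. f (x + y) = f x + f y) \<and> (\<forall>c x. f (c *s x) = c * f x)"
proof -
  have "vector_space ((*s) :: complex \<Rightarrow> complex ^ 'd \<Rightarrow> _)" by (rule vec.vector_space_axioms)
  moreover have "vector_space ((*) :: complex \<Rightarrow> _)"
    by unfold_locales (auto simp: algebra_simps)
  ultimately show ?thesis by (simp add: Vector_Spaces.linear_iff)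
qed

lemma entireI:
  assumes "\<And>z. (f has_derivative F z) (at z)"
    and "\<And>z x y. F z (x + y) = F z x + F z y" "\<And>z c x. F z (c *s x) = c * F z x"
  shows "f \<in> entire"
  unfolding entire_def vector_smult_linear_iff using assms by blast

text \<open>Chain rule along a complex line. Homogeneity of \<open>f'\<close> along \<open>v\<close>
  turns the real derivative into multiplication by the complex number \<open>f' v\<close>.\<close>

lemma entire_slice_has_field_derivative:
  fixes f :: "complex ^ 'd::finite \<Rightarrow> complex"
  assumes "(f has_derivative f') (at (z + t *s v))" "\<And>c. f' (c *s v) = c * f' v"
  shows "((\<lambda>s. f (z + s *s v)) has_field_derivative f' v) (at t)"
proof -
  have "((\<lambda>s. z + s *s v) has_derivative (\<lambda>s. s *s v)) (at t)"
  proof -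
    have "bounded_linear (\<lambda>s. s *s v)"
      by (rule bounded_linear_intro[where K="norm v"])
        (auto simp: vec_eq_iff algebra_simps norm_vector_smult)
    then show ?thesis by (auto intro!: derivative_eq_intros bounded_linear_imp_has_derivative)
  qed
  from diff_chain_at[OF this assms(1)]
  have "((\<lambda>s. f (z + s *s v)) has_derivative (\<lambda>c. c * f' v)) (at t)"
    using assms(2) by (simp add: o_def)
  moreover have "(\<lambda>c. c * f' v) = (*) (f' v)" by (simp add: fun_eq_iff mult.commute)
  ultimately show ?thesis by (simp only: has_field_derivative_def)
qed

text \<open>Whatever derivative the definition of \<open>entire\<close> provides, its values are
  forced by the complex lines through the point. So \<open>ddir\<close> serves as the canonical
  derivative and inherits complex linearity.\<close>

lemma entire_has_derivative:
  assumes "f \<in> entire"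
  shows "(f has_derivative (\<lambda>h. ddir h f z)) (at z)"
    and "ddir (x + y) f z = ddir x f z + ddir y f z"
    and "ddir (c *s x) f z = c * ddir x f z"
proof -
  obtain f' where f': "(f has_derivative f') (at z)" "\<And>x y. f' (x + y) = f' x + f' y"
    "\<And>c x. f' (c *s x) = c * f' x"
    using assms unfolding entire_def vector_smult_linear_iff by blast
  have eq: "ddir h f z = f' h" for h
    unfolding ddir_def
    by (rule DERIV_imp_deriv, rule entire_slice_has_field_derivative) (use f' in auto)
  show "(f has_derivative (\<lambda>h. ddir h f z)) (at z)" using f' by (simp add: eq)
  show "ddir (x + y) f z = ddir x f z + ddir y f z" "ddir (c *s x) f z = c * ddir x f z"
    using f' by (simp_all add: eq)
qed

lemma ddir_zero_direction [simp]: "ddir 0 f z = 0"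
  by (simp add: ddir_def)

lemma ddir_sum_direction:
  assumes "f \<in> entire"
  shows "ddir (\<Sum>i\<in>I. v i) f z = (\<Sum>i\<in>I. ddir (v i) f z)"
  by (induction I rule: infinite_finite_induct) (auto simp: entire_has_derivative[OF assms])

lemma pderiv_at_eq_ddir:
  assumes "f \<in> entire"
  shows "pderiv_at k f = ddir (axis k 1) f"
proof
  fix z
  \<comment> \<open>The line used by \<open>pderiv_at\<close> is parametrised by the
    \<open>k\<close>-th coordinate itself: it starts where that coordinate vanishes and reaches
    \<open>z\<close> at the parameter \<open>z $ k\<close>, not at 0.\<close>
  have "(\<lambda>w. f (\<chi> i. if i = k then w else z $ i)) = (\<lambda>w. f ((z - (z $ k) *s axis k 1) + w *s axis k 1))"
    by (intro ext arg_cong[of _ _ f]) (auto simp: vec_eq_iff axis_def)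
  moreover have "((\<lambda>w. f ((z - (z $ k) *s axis k 1) + w *s axis k 1)) has_field_derivative ddir (axis k 1) f z) (at (z $ k))"
    by (rule entire_slice_has_field_derivative)
      (simp_all add: entire_has_derivative assms)
  ultimately show "pderiv_at k f z = ddir (axis k 1) f z"
    unfolding pderiv_at_def by (simp add: DERIV_imp_deriv)
qed

lemma ddir_eq_sum_pderiv_at:
  assumes "f \<in> entire"
  shows "ddir v f z = (\<Sum>k\<in>UNIV. v $ k * pderiv_at k f z)"
proof -
  have "ddir v f z = ddir (\<Sum>k\<in>UNIV. v $ k *s axis k 1) f z" by (simp add: basis_expansion)
  then show ?thesis
    by (simp only: ddir_sum_direction[OF assms] entire_has_derivative[OF assms] pderiv_at_eq_ddir[OF assms])
qed

lemma entire_slice_deriv: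
  assumes "f \<in> entire"
  shows "((\<lambda>s. f (z + s *s v)) has_field_derivative ddir v f (z + t *s v)) (at t)"
  by (rule entire_slice_has_field_derivative) (use entire_has_derivative[OF assms] in auto)

lemma entire_slice_holomorphic:
  assumes "f \<in> entire"
  shows "(\<lambda>s. f (z + s *s v)) holomorphic_on A"
  using entire_slice_deriv[OF assms] by (meson holomorphic_onI has_field_derivative_at_within field_differentiable_def)

lemma entire_continuous_on: "f \<in> entire \<Longrightarrow> continuous_on A f"
  by (meson continuous_at_imp_continuous_on entire_has_derivative(1) has_derivative_continuous)

lemma entire_bounded_on_cball:
  fixes f :: "complex ^ 'd::finite \<Rightarrow> complex"
  assumes "f \<in> entire"
  obtains B where "B > 0" "\<forall>z\<in>cball 0 R. cmod (f z) \<le> B"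
proof -
  have "compact (f ` cball 0 R)"
    by (intro compact_continuous_image entire_continuous_on assms compact_cball)
  then have "bounded (f ` cball 0 R)" by (rule compact_imp_bounded)
  then show ?thesis using that by (auto simp: bounded_pos)
qed

section \<open>Algebra of entire functions and rules of differentiation\<close>

lemma entire_const [simp]: "(\<lambda>z. c) \<in> entire"
  by (rule entireI[where F="\<lambda>_ _. 0"]) auto

lemma entire_add: "f \<in> entire \<Longrightarrow> g \<in> entire \<Longrightarrow> (\<lambda>z. f z + g z) \<in> entire"
  by (rule entireI[where F="\<lambda>z h. ddir h f z + ddir h g z"])
    (auto intro!: derivative_intros simp: entire_has_derivative algebra_simps)

lemma entire_mult: "f \<in> entire \<Longrightarrow> g \<in> entire \<Longrightarrow> (\<lambda>z. f z * g z) \<in> entire"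
  by (rule entireI[where F="\<lambda>z h. f z * ddir h g z + ddir h f z * g z"])
    (rule has_derivative_mult, auto simp: entire_has_derivative algebra_simps)

lemma entire_cmult: "f \<in> entire \<Longrightarrow> (\<lambda>z. c * f z) \<in> entire"
  by (intro entire_mult entire_const)

lemma entire_diff: "f \<in> entire \<Longrightarrow> g \<in> entire \<Longrightarrow> (\<lambda>z. f z - g z) \<in> entire"
  using entire_add[of f "\<lambda>z. (-1) * g z"] entire_cmult[of g "-1"] by simp

lemma entire_sum: "(\<And>i. i \<in> I \<Longrightarrow> F i \<in> entire) \<Longrightarrow> (\<lambda>z. \<Sum>i\<in>I. F i z) \<in> entire"
  by (induction I rule: infinite_finite_induct) (auto intro: entire_add)

lemma entire_coordinate: "(\<lambda>z. z $ k) \<in> entire"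
  by (rule entireI[where F="\<lambda>_ h. h $ k"])
    (auto intro!: bounded_linear_imp_has_derivative bounded_linear_vec_nth)

lemma has_derivative_translate:
  "f \<in> entire \<Longrightarrow> ((\<lambda>z. f (z + v)) has_derivative (\<lambda>h. ddir h f (z + v))) (at z)"
proof -
  assume "f \<in> entire"
  have "((\<lambda>z. z + v) has_derivative (\<lambda>h. h)) (at z)" by (auto intro!: derivative_eq_intros)
  from diff_chain_at[OF this entire_has_derivative(1)[OF \<open>f \<in> entire\<close>]]
  show ?thesis by (simp add: o_def)
qed

lemma entire_translate: "f \<in> entire \<Longrightarrow> (\<lambda>z. f (z + v)) \<in> entire"
  by (rule entireI[OF has_derivative_translate]) (auto simp: entire_has_derivative)

lemma ddir_eqI:
  assumes "(f has_derivative F) (at z)" "\<And>c. F (c *s v) = c * F v"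
  shows "ddir v f z = F v"
  unfolding ddir_def by (rule DERIV_imp_deriv, rule entire_slice_has_field_derivative) (use assms in auto)

lemma ddir_translate:
  assumes "f \<in> entire" shows "ddir w (\<lambda>z. f (z + v)) = (\<lambda>z. ddir w f (z + v))"
  by (rule ext, rule ddir_eqI[OF has_derivative_translate]) (auto simp: entire_has_derivative assms)

lemma ddir_add:
  assumes "f \<in> entire" "g \<in> entire"
  shows "ddir v (\<lambda>z. f z + g z) = (\<lambda>z. ddir v f z + ddir v g z)"
  by (rule ext, rule ddir_eqI[where F="\<lambda>h. ddir h f z + ddir h g z" for z])
    (auto intro!: derivative_intros simp: entire_has_derivative assms algebra_simps)

lemma ddir_mult:
  assumes "f \<in> entire" "g \<in> entire"
  shows "ddir v (\<lambda>z. f z * g z) = (\<lambda>z. f z * ddir v g z + ddir v f z * g z)"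
  by (rule ext, rule ddir_eqI[where F="\<lambda>h. f z * ddir h g z + ddir h f z * g z" for z])
    (rule has_derivative_mult, auto simp: entire_has_derivative assms algebra_simps)

lemma ddir_const [simp]: "ddir v (\<lambda>z. c) = (\<lambda>z. 0)"
  by (simp add: ddir_def)

lemma ddir_cmult:
  assumes "f \<in> entire"
  shows "ddir v (\<lambda>z. c * f z) = (\<lambda>z. c * ddir v f z)"
  using ddir_mult[OF entire_const assms] by simp

lemma ddir_diff:
  assumes "f \<in> entire" "g \<in> entire"
  shows "ddir v (\<lambda>z. f z - g z) = (\<lambda>z. ddir v f z - ddir v g z)"
  using ddir_add[OF assms(1) entire_cmult[OF assms(2)], of v "-1"] ddir_cmult[OF assms(2), of v "-1"] by simp

lemma ddir_coordinate: "ddir v (\<lambda>z. z $ k) z = v $ k"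
  by (rule ddir_eqI) (auto intro!: bounded_linear_imp_has_derivative bounded_linear_vec_nth)

section \<open>Cauchy estimates on complex lines\<close>

lemma slice_higher_deriv_bound:
  assumes f: "f \<in> entire" and r: "r > 0" and B: "\<forall>z\<in>cball 0 (R + r * norm v). cmod (f z) \<le> B"
    and z: "z \<in> cball 0 R"
  shows "cmod ((deriv ^^ n) (\<lambda>t. f (z + t *s v)) 0) \<le> fact n * B / r ^ n"
proof (rule Cauchy_inequality[OF entire_slice_holomorphic[OF f] _ r])
  show "continuous_on (cball 0 r) (\<lambda>t. f (z + t *s v))"
    by (rule holomorphic_on_imp_continuous_on[OF entire_slice_holomorphic[OF f]])
  fix t :: complex assume "cmod (0 - t) = r"
  then have "norm (z + t *s v) \<le> R + r * norm v"
    using z norm_triangle_ineq[of z "t *s v"] by (simp add: norm_vector_smult)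
  then show "cmod (f (z + t *s v)) \<le> B" using B by simp
qed

lemma ddir_bound:
  assumes f: "f \<in> entire" and B: "\<forall>z\<in>cball 0 (R + 1). cmod (f z) \<le> B" and z: "z \<in> cball 0 R"
  shows "cmod (ddir v f z) \<le> B * norm v"
proof (cases "v = 0")
  case False
  \<comment> \<open>The parameter radius \<open>1 / norm v\<close> moves the point by distance
    exactly 1; this explains \<open>R + 1\<close> for all directions and the linear dependence on
    \<open>norm v\<close>.\<close>
  have "cmod ((deriv ^^ 1) (\<lambda>t. f (z + t *s v)) 0) \<le> fact 1 * B / (1 / norm v) ^ 1"
    by (rule slice_higher_deriv_bound[OF f _ _ z]) (use False B in auto)
  then show ?thesis by (simp add: ddir_def)
qed simp

section \<open>Locally uniform convergence\<close>

definition econv :: "(nat \<Rightarrow> complex ^ 'd::finite \<Rightarrow> complex) \<Rightarrow> (complex ^ 'd \<Rightarrow> complex) \<Rightarrow> bool" where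
  "econv F f \<longleftrightarrow> (\<forall>R. uniform_limit (cball 0 R) F f sequentially)"

lemma econv_pointwise: "econv F f \<Longrightarrow> (\<lambda>n. F n z) \<longlonglongrightarrow> f z"
  unfolding econv_def by (rule tendsto_uniform_limitI[where S="cball 0 (norm z)"]) auto

lemma econv_unique: "econv F f \<Longrightarrow> econv F g \<Longrightarrow> f = g"
  by (rule ext) (blast intro: LIMSEQ_unique econv_pointwise)

text \<open>Weierstrass's theorem. Cauchy's estimate turns uniform convergence on a ball into
  uniform convergence of the derivatives on a smaller one, and differentiation passes to the
  limit.\<close>

lemma econv_entire:
  fixes F :: "nat \<Rightarrow> complex ^ 'd::finite \<Rightarrow> complex"
  assumes F: "\<And>n. F n \<in> entire" and lim: "econv F f"
  shows "f \<in> entire"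
proof -
  let ?G = "\<lambda>z h. lim (\<lambda>n. ddir h (F n) z)"
  \<comment> \<open>An error proportional to \<open>norm h\<close> is the shape required for
    interchanging the limit with the Frechet derivative.\<close>
  have close: "\<exists>N. \<forall>m\<ge>N. \<forall>n\<ge>N. \<forall>z\<in>cball 0 R. \<forall>h. cmod (ddir h (F m) z - ddir h (F n) z) \<le> e * norm h"
    if e: "e > 0" for R e
  proof -
    have "\<forall>\<^sub>F n in sequentially. \<forall>z\<in>cball 0 (R+1). dist (F n z) (f z) < e / 2"
      using lim e unfolding econv_def by (intro uniform_limitD) auto
    then obtain N where N: "\<And>n z. n \<ge> N \<Longrightarrow> z \<in> cball 0 (R+1) \<Longrightarrow> dist (F n z) (f z) < e / 2"
      unfolding eventually_sequentially by blast
    have "cmod (ddir h (F m) z - ddir h (F n) z) \<le> e * norm h"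
      if "m \<ge> N" "n \<ge> N" "z \<in> cball 0 R" for m n z h
    proof -
      have "cmod (F m z - F n z) \<le> e" if "z \<in> cball 0 (R+1)" for z
      proof -
        have "dist (F m z) (F n z) < e / 2 + e / 2"
          by (rule order.strict_trans1[OF dist_triangle2 add_strict_mono]) (use N that \<open>m \<ge> N\<close> \<open>n \<ge> N\<close> in auto)
        then show ?thesis by (simp add: dist_norm)
      qed
      then have "cmod (ddir h (\<lambda>z. F m z - F n z) z) \<le> e * norm h"
        by (intro ddir_bound[where R=R] entire_diff F that) auto
      then show ?thesis by (simp add: ddir_diff F)
    qed
    then show ?thesis by blast
  qed
  have "\<exists>l. (\<lambda>n. ddir h (F n) z) \<longlonglongrightarrow> l" for h z
  proof -
    have "Cauchy (\<lambda>n. ddir h (F n) z)"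
    proof (rule CauchyI)
      fix e :: real assume "e > 0"
      \<comment> \<open>The summand 1 keeps the quotient meaningful for
        \<open>h = 0\<close>.\<close>
      then have "e / (norm h + 1) > 0" by (simp add: add_nonneg_pos)
      then obtain N where N: "\<And>m n x h'. m \<ge> N \<Longrightarrow> n\<ge>N \<Longrightarrow> x\<in>cball 0 (norm z) \<Longrightarrow>
          cmod (ddir h' (F m) x - ddir h' (F n) x) \<le> e / (norm h + 1) * norm h'"
        using close by metis
      have "e / (norm h + 1) * norm h < e"
        using \<open>e > 0\<close> by (simp add: field_simps add_pos_nonneg)
      then show "\<exists>N. \<forall>m\<ge>N. \<forall>n\<ge>N. cmod (ddir h (F m) z - ddir h (F n) z) < e"
        using N[of _ _ z h] by (intro exI[of _ N]) (auto intro: le_less_trans)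
    qed
    then show ?thesis by (simp add: Cauchy_convergent_iff convergent_def)
  qed
  then have G: "(\<lambda>n. ddir h (F n) z) \<longlonglongrightarrow> lim (\<lambda>n. ddir h (F n) z)" for h z
    by (simp add: convergent_LIMSEQ_iff[symmetric] convergent_def)
  have "(f has_derivative ?G z) (at z)" for z
  proof -
    \<comment> \<open>The open ball is convex and contains \<open>z\<close>; convergence at the
      single point \<open>z\<close> anchors the sequence, and the limit \<open>g\<close> is
      identified with \<open>f\<close> afterwards.\<close>
    have "\<exists>g. \<forall>x\<in>ball 0 (norm z + 1). (\<lambda>n. F n x) \<longlonglongrightarrow> g x \<and> (g has_derivative ?G x) (at x within ball 0 (norm z + 1))"
    proof (rule has_derivative_sequence[where f'="\<lambda>n x h. ddir h (F n) x"])
      fix e :: real assume "e > 0"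
      then obtain N where N: "\<And>m n x h. m \<ge> N \<Longrightarrow> n\<ge>N \<Longrightarrow> x\<in>cball 0 (norm z + 1) \<Longrightarrow> cmod (ddir h (F m) x - ddir h (F n) x) \<le> e * norm h"
        using close by metis
      have "cmod (ddir h (F m) x - ?G x h) \<le> e * norm h" if "m \<ge> N" "x \<in> ball 0 (norm z + 1)" for m x h
      proof (rule LIMSEQ_le_const2)
        show "(\<lambda>n. cmod (ddir h (F m) x - ddir h (F n) x)) \<longlonglongrightarrow> cmod (ddir h (F m) x - ?G x h)"
          by (intro tendsto_intros G)
        show "\<exists>N. \<forall>n\<ge>N. cmod (ddir h (F m) x - ddir h (F n) x) \<le> e * norm h"
          using N[of m _ x h] that by (intro exI[of _ N]) auto
      qed
      then show "\<forall>\<^sub>F n in sequentially. \<forall>x\<in>ball 0 (norm z + 1). \<forall>h. cmod (ddir h (F n) x - ?G x h) \<le> e * norm h"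
        unfolding eventually_sequentially by blast
    next
      fix n and x :: "complex ^ 'd" assume "x \<in> ball 0 (norm z + 1)"
      show "(F n has_derivative (\<lambda>h. ddir h (F n) x)) (at x within ball 0 (norm z + 1))"
        by (rule has_derivative_at_withinI[OF entire_has_derivative(1)[OF F]])
    next
      show "(\<lambda>n. F n z) \<longlonglongrightarrow> f z" by (rule econv_pointwise[OF lim])
    qed auto
    then obtain g where g: "\<And>x. x \<in> ball 0 (norm z + 1) \<Longrightarrow> (\<lambda>n. F n x) \<longlonglongrightarrow> g x"
      "\<And>x. x \<in> ball 0 (norm z + 1) \<Longrightarrow> (g has_derivative ?G x) (at x within ball 0 (norm z + 1))" by blast
    have "g x = f x" if "x \<in> ball 0 (norm z + 1)" for x
      using LIMSEQ_unique[OF g(1)[OF that] econv_pointwise[OF lim]] .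
    moreover have "z \<in> ball 0 (norm z + 1)" by simp
    ultimately have "(f has_derivative ?G z) (at z within ball 0 (norm z + 1))"
      using g(2)[of z] has_derivative_transform[of z "ball 0 (norm z + 1)" f g] by (metis (no_types, lifting))
    then show ?thesis by (metis \<open>z \<in> ball 0 (norm z + 1)\<close> at_within_open open_ball)
  qed
  moreover have "?G z (x + y) = ?G z x + ?G z y" for x y z
    by (rule LIMSEQ_unique[OF G]) (use tendsto_add[OF G[of x z] G[of y z]] in \<open>simp add: entire_has_derivative F\<close>)
  moreover have "?G z (c *s x) = c * ?G z x" for c x z
    by (rule LIMSEQ_unique[OF G]) (use tendsto_mult_left[OF G[of x z]] in \<open>simp add: entire_has_derivative F\<close>)
  ultimately show ?thesis by (rule entireI)
qed

section \<open>Bounded operators and Taylor expansions\<close>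

text \<open>Linearity together with continuity in terms of the seminorms given by balls. An
  arbitrary bound \<open>B\<close> stands in for the supremum, which also covers empty
  balls.\<close>

definition bounded_operator ::
    "((complex ^ 'd::finite \<Rightarrow> complex) \<Rightarrow> (complex ^ 'd \<Rightarrow> complex)) \<Rightarrow> bool" where
  "bounded_operator T \<longleftrightarrow>
     (\<forall>f\<in>entire. T f \<in> entire) \<and>
     (\<forall>f\<in>entire. \<forall>g\<in>entire. T (\<lambda>z. f z + g z) = (\<lambda>z. T f z + T g z)) \<and>
     (\<forall>c. \<forall>f\<in>entire. T (\<lambda>z. c * f z) = (\<lambda>z. c * T f z)) \<and>
     (\<forall>R. \<exists>C R'. C > 0 \<and> (\<forall>f\<in>entire. \<forall>B\<ge>0. (\<forall>z\<in>cball 0 R'. cmod (f z) \<le> B) \<longrightarrow>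
        (\<forall>z\<in>cball 0 R. cmod (T f z) \<le> C * B)))"

lemma bounded_operator_bound:
  assumes "bounded_operator T"
  obtains C R' where "C > 0" "\<And>f B z. f \<in> entire \<Longrightarrow> B \<ge> 0 \<Longrightarrow> (\<And>z. z \<in> cball 0 R' \<Longrightarrow> cmod (f z) \<le> B) \<Longrightarrow>
    z \<in> cball 0 R \<Longrightarrow> cmod (T f z) \<le> C * B"
  using assms unfolding bounded_operator_def by meson

lemma bounded_operator_entire: "bounded_operator T \<Longrightarrow> f \<in> entire \<Longrightarrow> T f \<in> entire"
  and bounded_operator_add: "bounded_operator T \<Longrightarrow> f \<in> entire \<Longrightarrow> g \<in> entire \<Longrightarrow>
    T (\<lambda>z. f z + g z) = (\<lambda>z. T f z + T g z)"
  and bounded_operator_cmult: "bounded_operator T \<Longrightarrow> f \<in> entire \<Longrightarrow> T (\<lambda>z. c * f z) = (\<lambda>z. c * T f z)"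
  unfolding bounded_operator_def by blast+

lemma bounded_operator_zero: "bounded_operator T \<Longrightarrow> T (\<lambda>z. 0) = (\<lambda>z. 0)"
  using bounded_operator_cmult[of T "\<lambda>z. 0" 0] by simp

lemma bounded_operator_diff:
  assumes "bounded_operator T" "f \<in> entire" "g \<in> entire"
  shows "T (\<lambda>z. f z - g z) = (\<lambda>z. T f z - T g z)"
  using bounded_operator_add[OF assms(1,2) entire_cmult[OF assms(3)], of "-1"]
    bounded_operator_cmult[OF assms(1,3), of "-1"] by simp

lemma bounded_operator_sum:
  assumes "bounded_operator T" "\<And>i. i \<in> I \<Longrightarrow> F i \<in> entire"
  shows "T (\<lambda>z. \<Sum>i\<in>I. c i * F i z) = (\<lambda>z. \<Sum>i\<in>I. c i * T (F i) z)"
  using assms(2)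
proof (induction I rule: infinite_finite_induct)
  case (insert x I)
  then show ?case
    by (simp add: bounded_operator_add[OF assms(1)] bounded_operator_cmult[OF assms(1)] entire_cmult entire_sum)
qed (use bounded_operator_zero[OF assms(1)] in auto)

lemma bounded_operator_funpow:
  assumes "bounded_operator T"
  shows "bounded_operator (T ^^ n)"
proof (induction n)
  case 0
  have "\<exists>C R'. C > 0 \<and> (\<forall>f\<in>entire. \<forall>B\<ge>0. (\<forall>z\<in>cball 0 R'. cmod (f z) \<le> B) \<longrightarrow>
        (\<forall>z\<in>cball 0 R. cmod ((T ^^ 0) f z) \<le> C * B))" for R
    by (intro exI[of _ 1] exI[of _ R]) auto
  then show ?case unfolding bounded_operator_def by auto
next
  case (Suc n)
  have "\<exists>C R'. C > 0 \<and> (\<forall>f\<in>entire. \<forall>B\<ge>0. (\<forall>z\<in>cball 0 R'. cmod (f z) \<le> B) \<longrightarrow>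
        (\<forall>z\<in>cball 0 R. cmod ((T ^^ Suc n) f z) \<le> C * B))" for R
  proof -
    obtain C R' where 1: "C > 0" "\<And>f B z. f \<in> entire \<Longrightarrow> B \<ge> 0 \<Longrightarrow> (\<And>z. z \<in> cball 0 R' \<Longrightarrow> cmod (f z) \<le> B) \<Longrightarrow>
      z \<in> cball 0 R \<Longrightarrow> cmod (T f z) \<le> C * B" using assms by (rule bounded_operator_bound) blast
    obtain D R'' where 2: "D > 0" "\<And>f B z. f \<in> entire \<Longrightarrow> B \<ge> 0 \<Longrightarrow> (\<And>z. z \<in> cball 0 R'' \<Longrightarrow> cmod (f z) \<le> B) \<Longrightarrow>
      z \<in> cball 0 R' \<Longrightarrow> cmod ((T ^^ n) f z) \<le> D * B" using Suc by (rule bounded_operator_bound) blast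
    have "cmod (T ((T ^^ n) f) z) \<le> C * (D * B)"
      if "f \<in> entire" "B \<ge> 0" "\<forall>z\<in>cball 0 R''. cmod (f z) \<le> B" "z \<in> cball 0 R" for f B z
      by (rule 1(2)) (use that 2 bounded_operator_entire[OF Suc] in auto)
    then show ?thesis using 1(1) 2(1) by (intro exI[of _ "C * D"] exI[of _ R'']) (auto simp: mult.assoc)
  qed
  with Suc show ?case
    unfolding bounded_operator_def
    by (simp add: bounded_operator_entire[OF assms] bounded_operator_add[OF assms] bounded_operator_cmult[OF assms])
qed

lemma bounded_operator_econv:
  assumes T: "bounded_operator T" and F: "\<And>n. F n \<in> entire" and f: "f \<in> entire" and lim: "econv F f"
  shows "econv (\<lambda>n. T (F n)) (T f)"
  unfolding econv_def
proof (intro allI uniform_limitI)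
  fix R e :: real assume e: "e > 0"
  obtain C R' where 1: "C > 0" "\<And>f B z. f \<in> entire \<Longrightarrow> B \<ge> 0 \<Longrightarrow> (\<And>z. z \<in> cball 0 R' \<Longrightarrow> cmod (f z) \<le> B) \<Longrightarrow>
      z \<in> cball 0 R \<Longrightarrow> cmod (T f z) \<le> C * B" using T by (rule bounded_operator_bound) blast
  have "\<forall>\<^sub>F n in sequentially. \<forall>z\<in>cball 0 R'. dist (F n z) (f z) < e / (2 * C)"
    using lim e 1(1) unfolding econv_def by (intro uniform_limitD) auto
  then show "\<forall>\<^sub>F n in sequentially. \<forall>z\<in>cball 0 R. dist (T (F n) z) (T f z) < e"
  proof eventually_elim
    case (elim n)
    show ?case
    proof
      fix z :: "complex ^ 'a" assume "z \<in> cball 0 R"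
      then have "cmod (T (\<lambda>z. F n z - f z) z) \<le> C * (e / (2 * C))"
        using elim e 1(1) by (intro 1(2) entire_diff F f) (auto simp: dist_norm less_imp_le)
      then show "dist (T (F n) z) (T f z) < e"
        using 1(1) e by (simp add: bounded_operator_diff[OF T F f] dist_norm)
    qed
  qed
qed

section \<open>From topological continuity to seminorm estimates\<close>

lemma continuous_linear_operator_imp_bounded:
  fixes T :: "(complex ^ 'd::finite \<Rightarrow> complex) \<Rightarrow> (complex ^ 'd \<Rightarrow> complex)"
  assumes "continuous_linear_operator T"
  shows "bounded_operator T"
proof -
  have cont: "continuous_map entire_topology entire_topology T"
    and add: "\<And>f g. f \<in> entire \<Longrightarrow> g \<in> entire \<Longrightarrow> T (\<lambda>z. f z + g z) = (\<lambda>z. T f z + T g z)"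
    and cm: "\<And>f c. f \<in> entire \<Longrightarrow> T (\<lambda>z. c * f z) = (\<lambda>z. c * T f z)"
    using assms unfolding continuous_linear_operator_def by blast+
  have ent: "T f \<in> entire" if "f \<in> entire" for f
    using cont that unfolding continuous_map_def topspace_entire_topology by auto
  have bd: "\<exists>C R'. C > 0 \<and> (\<forall>f\<in>entire. \<forall>B\<ge>0. (\<forall>z\<in>cball 0 R'. cmod (f z) \<le> B) \<longrightarrow>
        (\<forall>z\<in>cball 0 R. cmod (T f z) \<le> C * B))" for R
  proof -
    let ?U = "{g \<in> entire. \<forall>z\<in>cball 0 R. cmod (g z) < 1} :: (complex ^ 'd \<Rightarrow> complex) set"
    have "entire_open ?U"
    proof (rule entire_openI)
      fix f assume f: "f \<in> ?U"
      show "\<exists>K e. compact K \<and> e > 0 \<and> {g \<in> entire. \<forall>z\<in>K. cmod (g z - f z) < e} \<subseteq> ?U"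
      \<comment> \<open>For negative \<open>R\<close> the ball is empty and carries no maximum.
        Otherwise the distance from 1 of the maximum of \<open>cmod (f z)\<close> is the room for
        perturbation.\<close>
      proof (cases "cball 0 R = ({} :: (complex ^ 'd) set)")
        case True
        then show ?thesis by (intro exI[of _ "{}"] exI[of _ 1]) (auto simp del: cball_eq_empty)
      next
        case False
        have "continuous_on (cball 0 R) (\<lambda>z. cmod (f z))"
          using f by (intro continuous_on_norm entire_continuous_on) simp
        then obtain w where w: "w \<in> cball 0 R" "\<And>z. z \<in> cball 0 R \<Longrightarrow> cmod (f z) \<le> cmod (f w)"
          using continuous_attains_sup[OF compact_cball False] by blast
        have "cmod (f w) < 1" using f w by auto
        moreover have "{g \<in> entire. \<forall>z\<in>cball 0 R. cmod (g z - f z) < 1 - cmod (f w)} \<subseteq> ?U"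
        proof safe
          fix g and z :: "complex ^ 'd" assume g: "g \<in> entire" "\<forall>z\<in>cball 0 R. cmod (g z - f z) < 1 - cmod (f w)"
            and z: "z \<in> cball 0 R"
          have "cmod (g z) \<le> cmod (g z - f z) + cmod (f z)" by (metis diff_add_cancel norm_triangle_ineq)
          then show "cmod (g z) < 1" using g z w(2)[OF z] by fastforce
        qed
        ultimately show ?thesis by (intro exI[of _ "cball 0 R"] exI[of _ "1 - cmod (f w)"]) auto
      qed
    qed auto
    then have "openin entire_topology ?U" by (simp only: openin_entire_topology)
    with cont have "openin entire_topology {f \<in> topspace entire_topology. T f \<in> ?U}"
      by (rule openin_continuous_map_preimage)
    then have op: "entire_open {f \<in> entire. T f \<in> ?U}"
      by (simp only: openin_entire_topology topspace_entire_topology)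
    have T0: "T (\<lambda>z. 0) = (\<lambda>z. 0)" using cm[of "\<lambda>z. 0" 0] by simp
    then have mem: "(\<lambda>z. 0) \<in> {f \<in> entire. T f \<in> ?U}" by auto
    obtain K e where K: "compact K" "e > 0" "{g \<in> entire. \<forall>z\<in>K. cmod (g z - 0) < e} \<subseteq> {f \<in> entire. T f \<in> ?U}"
      by (rule entire_openE[OF op mem])
    obtain R' where R': "K \<subseteq> cball 0 R'"
      using bounded_subset_ballD[OF compact_imp_bounded[OF K(1)], of 0] ball_subset_cball by (meson order_trans)
    have "cmod (T f z) \<le> (2 / e) * B"
      if f: "f \<in> entire" and B: "B \<ge> 0" "\<forall>z\<in>cball 0 R'. cmod (f z) \<le> B" and z: "z \<in> cball 0 R" for f B z
    proof -
      \<comment> \<open>\<open>B\<close> may be 0, so the rescaling of \<open>f\<close> into the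
        neighbourhood divides by a larger \<open>B'\<close>, which then decreases to
        \<open>B\<close>. Aiming at half of \<open>e\<close> makes the inequality strict.\<close>
      have "cmod (T f z) \<le> (2 / e) * B'" if "B' > B" for B'
      proof -
        have B': "B' > 0" using B that by auto
        let ?c = "complex_of_real (e / (2 * B'))"
        have "cmod (?c * f x) < e" if "x \<in> K" for x
        proof -
          have "cmod (f x) \<le> B'" using B(2) R' that \<open>B' > B\<close> by fastforce
          then have "cmod (?c * f x) \<le> e / (2 * B') * B'"
            using K(2) B' unfolding norm_mult norm_of_real by (intro mult_mono) auto
          then show ?thesis using K(2) B' by auto
        qed
        then have "(\<lambda>x. ?c * f x) \<in> {f \<in> entire. T f \<in> ?U}"
          using K(3) f entire_cmult[of f ?c] by auto
        then have "cmod (T (\<lambda>x. ?c * f x) z) < 1" using z by blast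
        then have "cmod (?c * T f z) < 1" unfolding cm[OF f] .
        then have "e / (2 * B') * cmod (T f z) < 1"
          unfolding norm_mult norm_of_real using K(2) B' by simp
        then show ?thesis using K(2) B' by (simp add: field_simps)
      qed
      then have "cmod (T f z) * e / 2 \<le> B'" if "B' > B" for B'
        using that K(2) by (simp add: field_simps)
      then have "cmod (T f z) * e / 2 \<le> B" by (rule dense_ge)
      then show ?thesis using K(2) by (simp add: field_simps)
    qed
    then show ?thesis using K(2) by (intro exI[of _ "2 / e"] exI[of _ R']) auto
  qed
  show ?thesis unfolding bounded_operator_def using ent add cm bd by blast
qed

section \<open>Difference quotients and regularity of derivatives\<close>

lemma slice_remainder:
  assumes f: "f \<in> entire" and B: "\<forall>z\<in>cball 0 (R + norm v). cmod (f z) \<le> B" and z: "z \<in> cball 0 R"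
    and t: "cmod t \<le> 1/2"
  shows "cmod (f (z + t *s v) - f z - t * ddir v f z) \<le> 2 * B * cmod t ^ 2"
proof -
  define c where "c n = (deriv ^^ n) (\<lambda>t. f (z + t *s v)) 0 / fact n" for n
  \<comment> \<open>Cauchy's inequality on the unit disc bounds all Taylor coefficients of the slice
    by the same \<open>B\<close>, so the terms from degree 2 on are dominated by a geometric
    series.\<close>
  have cb: "cmod (c n) \<le> B" for n
    using slice_higher_deriv_bound[OF f zero_less_one _ z, of v B n] B
    by (simp add: c_def norm_divide field_simps)
  have "z \<in> cball 0 (R + norm v)" using z norm_ge_zero[of v] by (simp del: norm_ge_zero)
  then have "0 \<le> cmod (f z)" "cmod (f z) \<le> B" using B by auto
  then have B0: "0 \<le> B" by linarith
  have "(\<lambda>n. c n * t ^ n) sums f (z + t *s v)"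
    using holomorphic_power_series[OF entire_slice_holomorphic[OF f], of t 0 1 z v] t by (simp add: c_def)
  then have 1: "(\<lambda>n. c (n + 2) * t ^ (n + 2)) sums (f (z + t *s v) - (\<Sum>i<2. c i * t ^ i))"
    by (rule sums_split_initial_segment)
  have "(\<lambda>n. B * cmod t ^ 2 * cmod t ^ n) sums (B * cmod t ^ 2 * (1 / (1 - cmod t)))"
    using t by (intro sums_mult geometric_sums) auto
  moreover have "cmod (c (n + 2) * t ^ (n + 2)) \<le> B * cmod t ^ 2 * cmod t ^ n" for n
    using mult_right_mono[OF cb[of "n + 2"], of "cmod t ^ (n + 2)"]
    by (simp add: norm_mult norm_power power_add power2_eq_square mult_ac)
  ultimately have "cmod (f (z + t *s v) - (\<Sum>i<2. c i * t ^ i)) \<le> B * cmod t ^ 2 * (1 / (1 - cmod t))"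
    by (rule norm_sums_le[OF 1])
  also have "\<dots> \<le> B * cmod t ^ 2 * 2"
    using t B0 by (intro mult_left_mono) (auto simp: field_simps)
  also have "(\<Sum>i<2. c i * t ^ i) = f z + t * ddir v f z"
    by (simp add: c_def eval_nat_numeral ddir_def)
  finally show ?thesis by (simp add: algebra_simps)
qed

text \<open>The remainder is quadratic in the increment, so dividing by the increment still leaves a
  vanishing error. The derivative becomes a limit of combinations of translates, and facts about
  translates pass on to it.\<close>

lemma difference_quotient_econv:
  assumes f: "f \<in> entire"
  shows "econv (\<lambda>n z. of_nat (Suc n) * (f (z + (1 / of_nat (Suc n)) *s v) - f z)) (ddir v f)"
  unfolding econv_def
proof (intro allI uniform_limitI)
  fix R e :: real assume e: "e > 0"
  obtain B where B: "B > 0" "\<forall>z\<in>cball 0 (R + norm v). cmod (f z) \<le> B"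
    by (rule entire_bounded_on_cball[OF f])
  have ev: "\<forall>\<^sub>F n in sequentially. 2 * B / real (Suc n) < e"
  proof -
    have "(\<lambda>n. 2 * B * (1 / real (Suc n))) \<longlonglongrightarrow> 2 * B * 0"
      by (intro tendsto_intros LIMSEQ_Suc lim_1_over_n)
    then show ?thesis using e by (auto dest: order_tendstoD(2))
  qed
  show "\<forall>\<^sub>F n in sequentially. \<forall>z\<in>cball 0 R.
      dist (of_nat (Suc n) * (f (z + (1 / of_nat (Suc n)) *s v) - f z)) (ddir v f z) < e"
    \<comment> \<open>\<open>n > 0\<close> makes the increment \<open>1 / Suc n\<close> at most one
      half, as the remainder estimate requires.\<close>
    using ev eventually_gt_at_top[of 0]
  proof eventually_elim
    case (elim n)
    show ?case
    proof
      fix z :: "complex ^ 'a" assume z: "z \<in> cball 0 R"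
      define N where "N = Suc n"
      let ?t = "1 / of_nat N :: complex"
      have N: "N > 0" "N \<ge> 2" using elim by (auto simp: N_def)
      have t: "cmod ?t = 1 / real N" by (simp add: norm_divide)
      have "cmod (f (z + ?t *s v) - f z - ?t * ddir v f z) \<le> 2 * B * (1 / real N) ^ 2"
        using slice_remainder[OF f B(2) z, of ?t] N t by (auto simp: field_simps)
      have "of_nat N * (f (z + ?t *s v) - f z) - ddir v f z
        = of_nat N * (f (z + ?t *s v) - f z - ?t * ddir v f z)"
        using N by (simp add: field_simps)
      then have "cmod (of_nat N * (f (z + ?t *s v) - f z) - ddir v f z)
        = real N * cmod (f (z + ?t *s v) - f z - ?t * ddir v f z)"
        by (simp add: norm_mult)
      also have "\<dots> \<le> real N * (2 * B * (1 / real N) ^ 2)"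
        by (rule mult_left_mono) (fact, simp)
      also have "\<dots> < e" using elim N by (simp add: power2_eq_square N_def)
      finally show "dist (of_nat (Suc n) * (f (z + (1 / of_nat (Suc n)) *s v) - f z)) (ddir v f z) < e"
        by (simp add: dist_norm N_def)
    qed
  qed
qed

lemma difference_quotient_entire:
  "f \<in> entire \<Longrightarrow> (\<lambda>z. c * (f (z + w) - f z)) \<in> entire"
  by (intro entire_cmult entire_diff entire_translate)

lemma ddir_entire: "f \<in> entire \<Longrightarrow> ddir v f \<in> entire"
  by (rule econv_entire[OF difference_quotient_entire difference_quotient_econv])

lemma bounded_operator_ddir: "bounded_operator (ddir v)" for v :: "complex ^ 'd::finite"
proof -
  have "\<exists>C R'. C > 0 \<and> (\<forall>f\<in>entire. \<forall>B\<ge>0. (\<forall>z\<in>cball 0 R'. cmod (f z) \<le> B) \<longrightarrow>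
        (\<forall>z\<in>cball 0 R. cmod (ddir v f z) \<le> C * B))" for R
  proof (rule exI[of _ "norm v + 1"], rule exI[of _ "R + 1"], intro conjI ballI impI allI)
    fix f B and z :: "complex ^ 'd" assume "(f :: complex ^ 'd \<Rightarrow> complex) \<in> entire" "0 \<le> B" "\<forall>z\<in>cball 0 (R + 1). cmod (f z) \<le> B" "z \<in> cball 0 R"
    then have "cmod (ddir v f z) \<le> B * norm v" by (intro ddir_bound) auto
    then show "cmod (ddir v f z) \<le> (norm v + 1) * B" using \<open>0 \<le> B\<close> by (simp add: algebra_simps)
  qed (simp add: add_nonneg_pos)
  then show ?thesis
    unfolding bounded_operator_def by (simp add: ddir_entire ddir_add ddir_cmult)
qed

text \<open>Differentiation in one direction commutes with the difference quotients in the other.\<close>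

lemma ddir_commute:
  assumes f: "f \<in> entire"
  shows "ddir u (ddir v f) = ddir v (ddir u f)"
proof (rule econv_unique)
  let ?Q = "\<lambda>f n z. of_nat (Suc n) * (f (z + (1 / of_nat (Suc n)) *s v) - f z)"
  have "econv (\<lambda>n. ddir u (?Q f n)) (ddir u (ddir v f))"
    by (intro bounded_operator_econv[OF bounded_operator_ddir] difference_quotient_entire
        difference_quotient_econv ddir_entire f)
  moreover have "ddir u (?Q f n) = ?Q (ddir u f) n" for n
    by (simp add: ddir_cmult ddir_diff ddir_translate entire_diff entire_translate f)
  ultimately show "econv (?Q (ddir u f)) (ddir u (ddir v f))" by simp
  show "econv (?Q (ddir u f)) (ddir v (ddir u f))"
    by (intro difference_quotient_econv ddir_entire f)
qed

lemma ddir_funpow_entire: "f \<in> entire \<Longrightarrow> (ddir v ^^ n) f \<in> entire"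
  by (rule bounded_operator_entire[OF bounded_operator_funpow[OF bounded_operator_ddir]])

section \<open>Taylor expansions along complex lines\<close>

lemma higher_deriv_slice:
  assumes f: "f \<in> entire"
  shows "(deriv ^^ n) (\<lambda>t. f (z + t *s v)) = (\<lambda>t. (ddir v ^^ n) f (z + t *s v))"
proof (induction n)
  case (Suc n)
  show ?case
    by (simp add: Suc) (intro ext DERIV_imp_deriv entire_slice_deriv ddir_funpow_entire f)
qed simp

lemma ddir_funpow_bound:
  assumes "f \<in> entire" "r > 0" "\<forall>z\<in>cball 0 (R + r * norm v). cmod (f z) \<le> B" "z \<in> cball 0 R"
  shows "cmod ((ddir v ^^ n) f z) \<le> fact n * B / r ^ n"
  using slice_higher_deriv_bound[OF assms, of n] by (simp add: higher_deriv_slice assms(1))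

text \<open>Centre and increment both depend on a parameter, since the expansion is used with a
  fixed increment, jointly in both variables, and with a centre moving against a fixed
  endpoint.\<close>

lemma taylor_uniform_limit:
  fixes z v :: "'a \<Rightarrow> complex ^ 'd::finite"
  assumes f: "f \<in> entire" and z: "\<And>y. y \<in> A \<Longrightarrow> norm (z y) \<le> R" and v: "\<And>y. y \<in> A \<Longrightarrow> norm (v y) \<le> R"
  shows "uniform_limit A (\<lambda>N y. \<Sum>n<N. (ddir (v y) ^^ n) f (z y) / fact n) (\<lambda>y. f (z y + v y)) sequentially"
proof -
  \<comment> \<open>A parameter disc of radius 2 stays in the ball of radius
    \<open>R + 2 * R\<close>; the increment sits at parameter 1, so the terms decay like
    \<open>(1/2) ^ n\<close>.\<close>
  obtain B where B: "B > 0" "\<forall>z\<in>cball 0 (R + 2 * R). cmod (f z) \<le> B"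
    by (rule entire_bounded_on_cball[OF f])
  have bd: "cmod ((ddir (v y) ^^ n) f (z y) / fact n) \<le> B * (1/2) ^ n" if y: "y \<in> A" for y n
  proof -
    have "cmod ((ddir (v y) ^^ n) f (z y)) \<le> fact n * B / 2 ^ n"
      using B(2) z[OF y] v[OF y] by (intro ddir_funpow_bound[OF f, of _ R]) auto
    then show ?thesis by (simp add: norm_divide field_simps)
  qed
  have sm: "(\<lambda>n. (ddir (v y) ^^ n) f (z y) / fact n) sums f (z y + v y)" for y
    using holomorphic_power_series[OF entire_slice_holomorphic[OF f], of 1 0 2 "z y" "v y"]
    by (simp add: higher_deriv_slice[OF f])
  have "uniform_limit A (\<lambda>N y. \<Sum>n<N. (ddir (v y) ^^ n) f (z y) / fact n)
      (\<lambda>y. \<Sum>n. (ddir (v y) ^^ n) f (z y) / fact n) sequentially"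
    by (rule Weierstrass_m_test[OF bd]) (auto intro!: summable_mult)
  then show ?thesis by (simp only: sums_unique[OF sm, symmetric])
qed

section \<open>Subspaces invariant under differentiation\<close>

text \<open>Closure under limits of sequences is topological closedness here, as H(C^d) is
  metrizable.\<close>

definition entire_closed_subspace :: "(complex ^ 'd::finite \<Rightarrow> complex) set \<Rightarrow> bool" where
  "entire_closed_subspace M \<longleftrightarrow> M \<subseteq> entire \<and> (\<lambda>z. 0) \<in> M \<and>
     (\<forall>f\<in>M. \<forall>g\<in>M. (\<lambda>z. f z + g z) \<in> M) \<and> (\<forall>c. \<forall>f\<in>M. (\<lambda>z. c * f z) \<in> M) \<and>
     (\<forall>F g. (\<forall>n. F n \<in> M) \<longrightarrow> econv F g \<longrightarrow> g \<in> M)"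

lemma entire_closed_subspaceD:
  assumes "entire_closed_subspace M"
  shows "f \<in> M \<Longrightarrow> f \<in> entire" "(\<lambda>z. 0) \<in> M" "f \<in> M \<Longrightarrow> g \<in> M \<Longrightarrow> (\<lambda>z. f z + g z) \<in> M"
    "f \<in> M \<Longrightarrow> (\<lambda>z. c * f z) \<in> M" "(\<And>n. F n \<in> M) \<Longrightarrow> econv F g \<Longrightarrow> g \<in> M"
  using assms unfolding entire_closed_subspace_def by blast+

lemma entire_closed_subspace_diff:
  assumes "entire_closed_subspace M" "f \<in> M" "g \<in> M"
  shows "(\<lambda>z. f z - g z) \<in> M"
  using entire_closed_subspaceD(3)[OF assms(1,2) entire_closed_subspaceD(4)[OF assms(1,3), of "-1"]] by simp

lemma entire_closed_subspace_sum:
  assumes M: "entire_closed_subspace M" and F: "\<And>i. i \<in> I \<Longrightarrow> F i \<in> M"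
  shows "(\<lambda>z. \<Sum>i\<in>I. F i z) \<in> M"
  using F
  by (induction I rule: infinite_finite_induct) (auto intro: entire_closed_subspaceD[OF M])

lemma bounded_operator_pderiv_at_sum:
  assumes S: "bounded_operator S" and g: "g \<in> entire"
  shows "S (ddir v g) = (\<lambda>z. \<Sum>k\<in>UNIV. v $ k * S (pderiv_at k g) z)"
proof -
  have "ddir v g = (\<lambda>z. \<Sum>k\<in>UNIV. v $ k * pderiv_at k g z)"
    using ddir_eq_sum_pderiv_at[OF g] by auto
  then show ?thesis
    by (simp only: bounded_operator_sum[OF S] pderiv_at_eq_ddir[OF g] ddir_entire g)
qed

lemma pderiv_at_entire: "f \<in> entire \<Longrightarrow> pderiv_at k f \<in> entire"
  by (simp add: pderiv_at_eq_ddir ddir_entire)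

text \<open>Trades one directional derivative for coordinate derivatives, the coordinates of
  \<open>v\<close> becoming multipliers. The inductions in which the direction is a variable rest on
  this.\<close>

lemma ddir_funpow_Suc_expand:
  assumes f: "f \<in> entire"
  shows "(ddir v ^^ Suc n) f z = (\<Sum>k\<in>UNIV. v $ k * (ddir v ^^ n) (pderiv_at k f) z)"
  using bounded_operator_pderiv_at_sum[OF bounded_operator_funpow[OF bounded_operator_ddir] f, of n v v]
  by (simp add: funpow_swap1)

lemma taylor_econv:
  assumes f: "f \<in> entire"
  shows "econv (\<lambda>N z. \<Sum>n<N. (1 / fact n) * (ddir v ^^ n) f z) (\<lambda>z. f (z + v))"
  unfolding econv_def
proof
  fix R :: real
  show "uniform_limit (cball 0 R) (\<lambda>N z. \<Sum>n<N. (1 / fact n) * (ddir v ^^ n) f z) (\<lambda>z. f (z + v)) sequentially"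
    using taylor_uniform_limit[OF f, of "cball 0 R" "\<lambda>z. z" "max R (norm v)" "\<lambda>z. v"] by simp
qed

section \<open>Operators commuting with differentiation\<close>

lemma commuting_operator_translate:
  assumes S: "bounded_operator S"
    and comm: "\<And>k f. f \<in> entire \<Longrightarrow> S (pderiv_at k f) = pderiv_at k (S f)"
    and f: "f \<in> entire"
  shows "S (\<lambda>z. f (z + v)) = (\<lambda>z. S f (z + v))"
proof (rule econv_unique)
  have "S (ddir v g) = ddir v (S g)" if "g \<in> entire" for g
    using that bounded_operator_entire[OF S that]
    by (simp add: bounded_operator_pderiv_at_sum[OF S] comm fun_eq_iff ddir_eq_sum_pderiv_at)
  then have pow: "S ((ddir v ^^ n) f) = (ddir v ^^ n) (S f)" for n
    by (induction n) (simp_all add: ddir_funpow_entire f)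
  \<comment> \<open>Translation by \<open>v\<close> is the exponential series in
    \<open>ddir v\<close>; \<open>S\<close> commutes with its partial sums and, being continuous,
    with the limit.\<close>
  have "econv (\<lambda>N. S (\<lambda>z. \<Sum>n<N. (1 / fact n) * (ddir v ^^ n) f z)) (S (\<lambda>z. f (z + v)))"
    by (intro bounded_operator_econv[OF S] taylor_econv entire_sum entire_cmult ddir_funpow_entire entire_translate f)
  then show "econv (\<lambda>N z. \<Sum>n<N. (1 / fact n) * (ddir v ^^ n) (S f) z) (S (\<lambda>z. f (z + v)))"
    by (simp only: bounded_operator_sum[OF S] ddir_funpow_entire f pow)
  show "econv (\<lambda>N z. \<Sum>n<N. (1 / fact n) * (ddir v ^^ n) (S f) z) (\<lambda>z. S f (z + v))"
    by (intro taylor_econv bounded_operator_entire[OF S] f)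
qed

text \<open>In \<open>x\<close> this is \<open>q\<close> times a homogeneous polynomial of degree
  \<open>n\<close>. The weight \<open>q\<close> is carried along so that the induction can absorb
  coordinate factors.\<close>

lemma entire_mult_ddir_funpow:
  assumes "q \<in> entire" "g \<in> entire"
  shows "(\<lambda>x. q x * (ddir x ^^ n) g z) \<in> entire"
  using assms
proof (induction n arbitrary: q g)
  case 0
  then show ?case by (auto intro: entire_mult)
next
  case (Suc n)
  have "(\<lambda>x. q x * (ddir x ^^ Suc n) g z)
      = (\<lambda>x. \<Sum>k\<in>UNIV. (q x * x $ k) * (ddir x ^^ n) (pderiv_at k g) z)"
    by (simp only: ddir_funpow_Suc_expand[OF Suc.prems(2)] sum_distrib_left mult.assoc)
  also have "\<dots> \<in> entire"
    by (intro entire_sum Suc.IH entire_mult entire_coordinate pderiv_at_entire Suc.prems)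
  finally show ?case .
qed

text \<open>\<open>S\<close> acts on \<open>x\<close> while \<open>z\<close> is a parameter.
  Expanding the polynomial in \<open>x\<close> leaves a combination of derivatives of
  \<open>g\<close> at \<open>z\<close> whose coefficients are values of \<open>S\<close> at the
  origin, hence constants.\<close>

lemma operator_taylor_coefficient_mem:
  assumes S: "bounded_operator S" and M: "entire_closed_subspace M"
    and D: "\<And>g k. g \<in> M \<Longrightarrow> pderiv_at k g \<in> M"
    and "q \<in> entire" "g \<in> M"
  shows "(\<lambda>z. S (\<lambda>x. q x * (ddir x ^^ n) g z) 0) \<in> M"
  using assms(4,5)
proof (induction n arbitrary: q g)
  case 0
  have "S (\<lambda>x. q x * g z) 0 = S q 0 * g z" for z
    using bounded_operator_cmult[OF S 0(1), of "g z"] by (simp add: mult.commute fun_eq_iff)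
  then show ?case using entire_closed_subspaceD(4)[OF M 0(2)] by simp
next
  case (Suc n)
  note g = entire_closed_subspaceD(1)[OF M Suc.prems(2)]
  have "(\<lambda>x. q x * (ddir x ^^ Suc n) g z)
      = (\<lambda>x. \<Sum>k\<in>UNIV. 1 * ((q x * x $ k) * (ddir x ^^ n) (pderiv_at k g) z))" for z
    by (simp only: ddir_funpow_Suc_expand[OF g] sum_distrib_left mult.assoc mult_1)
  moreover have "S (\<lambda>x. \<Sum>k\<in>UNIV. 1 * ((q x * x $ k) * (ddir x ^^ n) (pderiv_at k g) z))
      = (\<lambda>y. \<Sum>k\<in>UNIV. 1 * S (\<lambda>x. (q x * x $ k) * (ddir x ^^ n) (pderiv_at k g) z) y)" for z
    by (intro bounded_operator_sum[OF S] entire_mult_ddir_funpow entire_mult entire_coordinate pderiv_at_entire g Suc.prems)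
  ultimately have "(\<lambda>z. S (\<lambda>x. q x * (ddir x ^^ Suc n) g z) 0)
      = (\<lambda>z. \<Sum>k\<in>UNIV. S (\<lambda>x. (q x * x $ k) * (ddir x ^^ n) (pderiv_at k g) z) 0)"
    by simp
  also have "\<dots> \<in> M"
    by (intro entire_closed_subspace_sum[OF M] Suc.IH entire_mult entire_coordinate D Suc.prems)
  finally show ?case .
qed

lemma commuting_operator_mem:
  fixes S :: "(complex ^ 'd::finite \<Rightarrow> complex) \<Rightarrow> (complex ^ 'd \<Rightarrow> complex)"
  assumes S: "bounded_operator S"
    and comm: "\<And>k f. f \<in> entire \<Longrightarrow> S (pderiv_at k f) = pderiv_at k (S f)"
    and M: "entire_closed_subspace M"
    and D: "\<And>g k. g \<in> M \<Longrightarrow> pderiv_at k g \<in> M"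
    and g: "g \<in> M"
  shows "S g \<in> M"
proof (rule entire_closed_subspaceD(5)[OF M])
  note ge = entire_closed_subspaceD(1)[OF M g]
  let ?t = "\<lambda>n z x. (ddir x ^^ n) g z"
  let ?F = "\<lambda>N z. \<Sum>n<N. (1 / fact n) * S (\<lambda>x. 1 * ?t n z x) 0"
  show "?F N \<in> M" for N
    by (intro entire_closed_subspace_sum[OF M] entire_closed_subspaceD(4)[OF M]
        operator_taylor_coefficient_mem[OF S M D] entire_const g)
  show "econv ?F (S g)"
    unfolding econv_def
  proof (intro allI uniform_limitI)
    fix R e :: real assume e: "e > 0"
    \<comment> \<open>Only the value of \<open>S\<close> at the origin is estimated, hence the
      degenerate ball \<open>cball 0 0\<close>.\<close>
    obtain C R' where 1: "C > 0" "\<And>f B z. f \<in> entire \<Longrightarrow> B \<ge> 0 \<Longrightarrow> (\<And>z. z \<in> cball 0 R' \<Longrightarrow> cmod (f z) \<le> B) \<Longrightarrow>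
      z \<in> cball 0 0 \<Longrightarrow> cmod (S f z) \<le> C * B" using S by (rule bounded_operator_bound) blast
    \<comment> \<open>Uniformity is needed at once in \<open>x\<close> on the ball that controls
      \<open>S\<close> and in \<open>z\<close> on the target ball, hence the product set.\<close>
    have "uniform_limit (cball 0 R \<times> cball 0 R') (\<lambda>N y. \<Sum>n<N. ?t n (fst y) (snd y) / fact n)
        (\<lambda>y. g (fst y + snd y)) sequentially"
      by (rule taylor_uniform_limit[OF ge, of _ _ "max R R'"]) auto
    then have "uniform_limit (cball 0 R \<times> cball 0 R') (\<lambda>N y. \<Sum>n<N. ?t n (fst y) (snd y) / fact n)
        (\<lambda>y. g (snd y + fst y)) sequentially" by (simp add: add.commute)
    from uniform_limitD[OF this, of "e / (2 * C)"]
    have "\<forall>\<^sub>F N in sequentially. \<forall>z\<in>cball 0 R. \<forall>x\<in>cball 0 R'.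
        dist (\<Sum>n<N. ?t n z x / fact n) (g (x + z)) < e / (2 * C)"
      using e 1(1) by simp
    then show "\<forall>\<^sub>F N in sequentially. \<forall>z\<in>cball 0 R. dist (?F N z) (S g z) < e"
    proof eventually_elim
      case (elim N)
      show ?case
      proof
        fix z :: "complex ^ 'd" assume z: "z \<in> cball 0 R"
        let ?G = "\<lambda>x. \<Sum>n<N. (1 / fact n) * (1 * ?t n z x)"
        have t: "(\<lambda>x. 1 * ?t n z x) \<in> entire" for n
          by (intro entire_mult_ddir_funpow entire_const ge)
        have G: "?G \<in> entire" by (intro entire_sum entire_cmult t)
        have gz: "(\<lambda>x. g (x + z)) \<in> entire" by (rule entire_translate[OF ge])
        have tr: "S (\<lambda>x. g (x + z)) 0 = S g z"
          by (subst commuting_operator_translate[OF S comm ge]) simp_all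
        have "cmod (S (\<lambda>x. ?G x - g (x + z)) 0) \<le> C * (e / (2 * C))"
          using elim z e 1(1)
          by (intro 1(2) entire_diff G gz) (auto simp: dist_norm less_imp_le)
        moreover have "S (\<lambda>x. ?G x - g (x + z)) 0 = ?F N z - S g z"
          unfolding bounded_operator_diff[OF S G gz] bounded_operator_sum[OF S t]
            tr by simp
        ultimately show "dist (?F N z) (S g z) < e" using e 1(1) by (simp add: dist_norm)
      qed
    qed
  qed
qed

section \<open>Closed subspaces invariant under multiplication by coordinates\<close>

lemma recentred_derivative_mem:
  assumes M: "entire_closed_subspace M" and D: "\<And>g k. g \<in> M \<Longrightarrow> pderiv_at k g \<in> M"
    and mult: "\<And>g k. g \<in> M \<Longrightarrow> (\<lambda>z. z $ k * g z) \<in> M" and "g \<in> M"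
  shows "(\<lambda>z. (ddir (u - z) ^^ n) g z) \<in> M"
  using assms(4)
proof (induction n arbitrary: g)
  case (Suc n)
  let ?h = "\<lambda>k z. (ddir (u - z) ^^ n) (pderiv_at k g) z"
  have h: "?h k \<in> M" for k by (intro Suc.IH D Suc.prems)
  \<comment> \<open>The direction varies with the point, so each unfolding brings the multipliers
    \<open>u $ k - z $ k\<close>; this is where multiplication by coordinates enters.\<close>
  have "(\<lambda>z. (ddir (u - z) ^^ Suc n) g z) = (\<lambda>z. \<Sum>k\<in>UNIV. u $ k * ?h k z - z $ k * ?h k z)"
    by (simp only: ddir_funpow_Suc_expand[OF entire_closed_subspaceD(1)[OF M Suc.prems]]
        vector_minus_component left_diff_distrib)
  also have "\<dots> \<in> M"
    by (intro entire_closed_subspace_sum[OF M] entire_closed_subspace_diff[OF M] entire_closed_subspaceD(4)[OF M] mult h)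
  finally show ?case .
qed simp

text \<open>For fixed \<open>z\<close> the derivatives of \<open>h\<close> are constants, so only
  polynomial multiples of \<open>q\<close> occur. With \<open>q\<close> constantly 1 and
  \<open>z = 0\<close> these give the Taylor terms of \<open>h\<close>.\<close>

lemma homogeneous_taylor_term_mem:
  assumes M: "entire_closed_subspace M" and mult: "\<And>g k. g \<in> M \<Longrightarrow> (\<lambda>z. z $ k * g z) \<in> M"
    and "q \<in> M" "h \<in> entire"
  shows "(\<lambda>x. q x * (ddir x ^^ n) h z) \<in> M"
  using assms(3,4)
proof (induction n arbitrary: q h)
  case 0
  then show ?case using entire_closed_subspaceD(4)[OF M, of q "h z"] by (simp add: mult.commute)
next
  case (Suc n)
  have "(\<lambda>x. q x * (ddir x ^^ Suc n) h z)
      = (\<lambda>x. \<Sum>k\<in>UNIV. (x $ k * q x) * (ddir x ^^ n) (pderiv_at k h) z)"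
    by (simp only: ddir_funpow_Suc_expand[OF Suc.prems(2)] sum_distrib_left mult_ac)
  also have "\<dots> \<in> M"
    by (intro entire_closed_subspace_sum[OF M] Suc.IH mult pderiv_at_entire Suc.prems)
  finally show ?case .
qed

lemma invariant_ideal_eq_entire:
  assumes M: "entire_closed_subspace M" and D: "\<And>g k. g \<in> M \<Longrightarrow> pderiv_at k g \<in> M"
    and mult: "\<And>g k. g \<in> M \<Longrightarrow> (\<lambda>z. z $ k * g z) \<in> M" and f: "f \<in> M" "f u \<noteq> 0"
  shows "M = entire"
proof
  show "M \<subseteq> entire" using entire_closed_subspaceD(1)[OF M] by blast
  note fe = entire_closed_subspaceD(1)[OF M f(1)]
  have "(\<lambda>z. f u) \<in> M"
  proof (rule entire_closed_subspaceD(5)[OF M])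
    show "(\<lambda>z. \<Sum>n<N. (1 / fact n) * (ddir (u - z) ^^ n) f z) \<in> M" for N
      by (intro entire_closed_subspace_sum[OF M] entire_closed_subspaceD(4)[OF M]
          recentred_derivative_mem[OF M D mult] f)
    show "econv (\<lambda>N z. \<Sum>n<N. (1 / fact n) * (ddir (u - z) ^^ n) f z) (\<lambda>z. f u)"
      unfolding econv_def
    proof
      fix R
      have "norm (u - z) \<le> norm u + \<bar>R\<bar>" if "z \<in> cball 0 R" for z
        using norm_triangle_ineq4[of u z] that by simp
      then have "uniform_limit (cball 0 R) (\<lambda>N z. \<Sum>n<N. (ddir (u - z) ^^ n) f z / fact n) (\<lambda>z. f (z + (u - z))) sequentially"
        by (intro taylor_uniform_limit[OF fe, where R="norm u + \<bar>R\<bar>"]) (auto intro: order_trans[OF _ norm_ge_zero] simp: add_increasing)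
      then show "uniform_limit (cball 0 R) (\<lambda>N z. \<Sum>n<N. (1 / fact n) * (ddir (u - z) ^^ n) f z) (\<lambda>z. f u) sequentially"
        by simp
    qed
  qed
  from entire_closed_subspaceD(4)[OF M this, of "1 / f u"]
  have one: "(\<lambda>z. 1) \<in> M" using f by simp
  \<comment> \<open>From the constant 1 one reaches all Taylor polynomials at the origin; the
    increment is now the variable.\<close>
  show "entire \<subseteq> M"
  proof
    fix h :: "complex ^ 'a \<Rightarrow> complex" assume h: "h \<in> entire"
    show "h \<in> M"
    proof (rule entire_closed_subspaceD(5)[OF M])
      show "(\<lambda>x. \<Sum>n<N. (1 / fact n) * (1 * (ddir x ^^ n) h 0)) \<in> M" for N
        by (intro entire_closed_subspace_sum[OF M] entire_closed_subspaceD(4)[OF M]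
            homogeneous_taylor_term_mem[OF M mult] one h)
      show "econv (\<lambda>N x. \<Sum>n<N. (1 / fact n) * (1 * (ddir x ^^ n) h 0)) h"
        unfolding econv_def
      proof
        fix R :: real
        show "uniform_limit (cball 0 R) (\<lambda>N x. \<Sum>n<N. (1 / fact n) * (1 * (ddir x ^^ n) h 0)) h sequentially"
          using taylor_uniform_limit[OF h, of "cball 0 R" "\<lambda>x. 0" "\<bar>R\<bar>" "\<lambda>x. x"] by simp
      qed
    qed
  qed
qed

section \<open>Ladder operators and multiplication by coordinates\<close>

lemma bounded_operator_add_coordinate:
  fixes T :: "(complex ^ 'd::finite \<Rightarrow> complex) \<Rightarrow> (complex ^ 'd \<Rightarrow> complex)"
  assumes T: "bounded_operator T"
  shows "bounded_operator (\<lambda>f z. T f z + c * (z $ j * f z))"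
proof -
  have "\<exists>C R'. C > 0 \<and> (\<forall>f\<in>entire. \<forall>B\<ge>0. (\<forall>z\<in>cball 0 R'. cmod (f z) \<le> B) \<longrightarrow>
        (\<forall>z\<in>cball 0 R. cmod (T f z + c * (z $ j * f z)) \<le> C * B))" for R
  proof -
    obtain C R' where 1: "C > 0" "\<And>f B z. f \<in> entire \<Longrightarrow> B \<ge> 0 \<Longrightarrow> (\<And>z. z \<in> cball 0 R' \<Longrightarrow> cmod (f z) \<le> B) \<Longrightarrow>
      z \<in> cball 0 R \<Longrightarrow> cmod (T f z) \<le> C * B" using T by (rule bounded_operator_bound) blast
    \<comment> \<open>Multiplication by \<open>z $ j\<close> needs the bound for \<open>f\<close> on
      the target ball itself, hence \<open>max R R'\<close>; the absolute value keeps the constant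
      positive for negative \<open>R\<close>.\<close>
    have "cmod (T f z + c * (z $ j * f z)) \<le> (C + cmod c * \<bar>R\<bar>) * B"
      if f: "f \<in> entire" "B \<ge> 0" "\<forall>z\<in>cball 0 (max R R'). cmod (f z) \<le> B" "z \<in> cball 0 R" for f B z
    proof -
      have "cmod (T f z) \<le> C * B" using that by (intro 1(2)) auto
      moreover have "cmod (z $ j) \<le> \<bar>R\<bar>" using Finite_Cartesian_Product.norm_nth_le[of z j] f(4) by simp
      then have "cmod c * (cmod (z $ j) * cmod (f z)) \<le> cmod c * (\<bar>R\<bar> * B)"
        using f by (intro mult_left_mono mult_mono) auto
      ultimately show ?thesis
        using norm_triangle_ineq[of "T f z" "c * (z $ j * f z)"] by (simp add: norm_mult algebra_simps)
    qed
    moreover have "C + cmod c * \<bar>R\<bar> > 0" using 1(1) by (simp add: add_pos_nonneg)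
    ultimately show ?thesis by blast
  qed
  then show ?thesis
    unfolding bounded_operator_def
    by (auto simp: bounded_operator_add[OF T] bounded_operator_cmult[OF T] algebra_simps
        intro!: entire_add entire_cmult entire_mult entire_coordinate bounded_operator_entire[OF T])
qed

lemma ladder_invariant_subspace_eq_entire:
  assumes T: "\<And>j. bounded_operator (T j)" and a: "\<And>j. a j \<noteq> 0"
    and comm: "\<And>j k f. f \<in> entire \<Longrightarrow>
      T j (pderiv_at k f) = (\<lambda>z. pderiv_at k (T j f) z + (if j = k then a j else 0) * f z)"
    and M: "entire_closed_subspace M" and D: "\<And>g k. g \<in> M \<Longrightarrow> pderiv_at k g \<in> M"
    and TM: "\<And>j g. g \<in> M \<Longrightarrow> T j g \<in> M" and f: "f \<in> M" "f u \<noteq> 0"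
  shows "M = entire"
proof (rule invariant_ideal_eq_entire[OF M D _ f])
  fix g and k assume g: "g \<in> M"
  let ?S = "\<lambda>f z. T k f z + a k * (z $ k * f z)"
  have S: "bounded_operator ?S" by (rule bounded_operator_add_coordinate[OF T])
  \<comment> \<open>The product rule for \<open>z $ k * f z\<close> yields an extra
    \<open>a k * f z\<close> exactly when \<open>k = l\<close>, matching the commutator term of
    \<open>T k\<close>.\<close>
  have "?S (pderiv_at l f) = pderiv_at l (?S f)" if f: "f \<in> entire" for l f
  proof -
    have Tf: "T k f \<in> entire" by (rule bounded_operator_entire[OF T f])
    have zf: "(\<lambda>z. z $ k * f z) \<in> entire" by (intro entire_mult entire_coordinate f)
    have "?S f \<in> entire" by (intro entire_add entire_cmult Tf zf)
    then have "pderiv_at l (?S f) = (\<lambda>z. pderiv_at l (T k f) z + a k * (z $ k * pderiv_at l f z + (if k = l then 1 else 0) * f z))"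
      by (simp add: pderiv_at_eq_ddir Tf f ddir_add[OF Tf entire_cmult[OF zf]] ddir_cmult[OF zf]
          ddir_mult[OF entire_coordinate f] ddir_coordinate axis_def)
    then show ?thesis by (auto simp: comm[OF f] algebra_simps)
  qed
  then have "?S g \<in> M" by (intro commuting_operator_mem[OF S _ M D g])
  from entire_closed_subspaceD(4)[OF M entire_closed_subspace_diff[OF M this TM[OF g, of k]], of "1 / a k"]
  show "(\<lambda>z. z $ k * g z) \<in> M" using a[of k] by simp
qed

section \<open>A frequent hypercyclicity criterion\<close>

text \<open>Linear growth of an injective enumeration puts at least \<open>N div D\<close> members
  up to \<open>N\<close>, whatever their order; for \<open>N \<ge> 2 * D\<close> this is at least
  \<open>N / (2 * D)\<close>.\<close>

lemma lower_density_pos: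
  assumes f: "inj f" "\<And>t. f t \<in> A" "\<And>t. f t \<le> D * Suc t"
  shows "lower_density A > 0"
proof -
  have D: "D > 0"
  proof (rule ccontr)
    assume "\<not> D > 0"
    then have "f 0 = f 1" using f(3)[of 0] f(3)[of 1] by simp
    then show False using injD[OF f(1), of 0 1] by simp
  qed
  have "ereal (1 / (2 * real D)) \<le> ereal (real (card {n \<in> A. n \<le> N}) / real N)" if N: "N \<ge> 2 * D" for N
  proof -
    have "f t \<le> N" if "t < N div D" for t
    proof -
      have "D * Suc t \<le> D * (N div D)" using that by (intro mult_left_mono) auto
      then show ?thesis using f(3)[of t] by (meson order_trans times_div_less_eq_dividend)
    qed
    then have "f ` {..<N div D} \<subseteq> {n \<in> A. n \<le> N}" using f(2) by auto
    then have "card (f ` {..<N div D}) \<le> card {n \<in> A. n \<le> N}" by (intro card_mono) auto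
    then have card: "N div D \<le> card {n \<in> A. n \<le> N}"
      using f(1) by (simp add: card_image inj_on_subset[OF f(1)])
    have "real N = real D * real (N div D) + real (N mod D)"
      by (metis mult_div_mod_eq of_nat_add of_nat_mult)
    moreover have "real (N mod D) \<le> real D" using D by (simp add: less_imp_le)
    moreover have "2 * real D \<le> real N" using N by linarith
    ultimately have "real N \<le> 2 * real D * real (N div D)" by linarith
    also have "\<dots> \<le> 2 * real D * real (card {n \<in> A. n \<le> N})"
      using card by (intro mult_left_mono) auto
    finally show ?thesis using D N by (simp add: field_simps)
  qed
  then have "ereal (1 / (2 * real D)) \<le> lower_density A"
    unfolding lower_density_def
    by (intro Liminf_bounded) (auto simp: eventually_sequentially)
  moreover have "0 < ereal (1 / (2 * real D))" using D by simp
  ultimately show ?thesis by (rule less_le_trans[rotated])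
qed

section \<open>Dyadic valuations and well-spaced times\<close>

abbreviation dyadic :: "nat \<Rightarrow> nat" where
  "dyadic \<equiv> multiplicity 2"

lemma dyadic_double: "m > 0 \<Longrightarrow> dyadic (2 * m) = Suc (dyadic m)"
  by (rule multiplicity_times_same) auto

lemma dyadic_odd: "dyadic (Suc (2 * m)) = 0"
  by (rule not_dvd_imp_multiplicity_0) simp

lemma dyadic_power_times_odd: "dyadic (2 ^ l * Suc (2 * t)) = l"
proof (induction l)
  case (Suc l)
  then show ?case using dyadic_double[of "2 ^ l * Suc (2 * t)"] by (simp only: power_Suc mult.assoc) simp
qed (simp add: dyadic_odd)

text \<open>The sum is the exponent of 2 in the factorial of \<open>n\<close>; halving
  \<open>n\<close> computes it recursively.\<close>

lemma sum_dyadic_le: "(\<Sum>i\<le>n. dyadic i) \<le> n"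
proof (induction n rule: less_induct)
  case (less n)
  \<comment> \<open>Odd indices contribute nothing, and each positive even index contributes one
    more than its half.\<close>
  have double: "(\<Sum>i\<le>2 * m. dyadic i) = m + (\<Sum>i\<le>m. dyadic i)" for m
  proof (induction m)
    case (Suc m)
    have "dyadic (Suc (Suc (2 * m))) = Suc (dyadic (Suc m))"
      using dyadic_double[of "Suc m"] by simp
    then show ?case using Suc by (simp add: dyadic_odd)
  qed simp
  consider "n = 0" | m where "n = 2 * m" "m > 0" | m where "n = Suc (2 * m)"
    by (metis even_Suc evenE gr0I mult_0_right oddE Suc_eq_plus1)
  then show ?case
  proof cases
    case 2
    then show ?thesis using less[of m] by (simp add: double)
  next
    case 3
    then show ?thesis using less[of m] by (simp add: double dyadic_odd)
  qed simp
qed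

text \<open>The gap between two values exceeds the dyadic valuations of both indices, yet the growth is linear
  since the valuations have bounded mean. So each set \<open>{spaced n | n. dyadic n = l}\<close> has positive
  lower density.\<close>

primrec spaced :: "nat \<Rightarrow> nat" where
  "spaced 0 = 0"
| "spaced (Suc n) = spaced n + 1 + dyadic n + dyadic (Suc n)"

lemma spaced_le: "spaced n \<le> 3 * n"
proof -
  \<comment> \<open>Each valuation enters two consecutive gaps, whence the factor 2; the added
    \<open>dyadic n\<close> accounts for the last one, of which only one gap is included so
    far.\<close>
  have "spaced n + dyadic n \<le> n + 2 * (\<Sum>i\<le>n. dyadic i)"
    by (induction n) auto
  then show ?thesis using sum_dyadic_le[of n] by linarith
qed

text \<open>The two valuations will serve as waiting times for the two stages involved; the term
  \<open>n - m\<close> makes sums over later indices geometric.\<close>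

lemma spaced_gap: "m < n \<Longrightarrow> spaced m + (n - m) + dyadic m + dyadic n \<le> spaced n"
proof (induction n)
  case (Suc n)
  then show ?case by (cases "m = n") auto
qed simp

lemma inj_spaced: "inj spaced"
proof (rule injI)
  fix m n assume "spaced m = spaced n"
  then show "m = n" using spaced_gap[of m n] spaced_gap[of n m] by (cases m n rule: linorder_cases) auto
qed

text \<open>\<open>N i R\<close> is the time after which the \<open>i\<close>-th sequence is small on the ball of radius \<open>R\<close>. The
  enumeration \<open>h\<close> and the radii \<open>\<rho>\<close> grow so slowly that stage \<open>k\<close> only meets thresholds up to \<open>k\<close>.\<close>

lemma slow_indexing:
  fixes N :: "nat \<Rightarrow> nat \<Rightarrow> nat"
  assumes "N 0 0 = 0"
  obtains \<rho> h where "mono \<rho>" "\<And>k i R. i \<le> \<rho> k \<Longrightarrow> R \<le> \<rho> k \<Longrightarrow> N i R \<le> k"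
    "\<And>k. h k \<le> \<rho> k" "\<And>i r k. \<exists>l\<ge>k. h l = i \<and> r \<le> \<rho> l"
proof -
  \<comment> \<open>The bound \<open>r \<le> k\<close> keeps the set finite, and
    \<open>N 0 0 = 0\<close> puts 0 into it.\<close>
  let ?A = "\<lambda>k. {r. r \<le> k \<and> (\<forall>i\<le>r. \<forall>R\<le>r. N i R \<le> k)}"
  define \<rho> where "\<rho> k = Max (?A k)" for k
  \<comment> \<open>The first component of the pairing takes every value infinitely often; values
    still too large for \<open>\<rho> l\<close> are replaced by 0.\<close>
  define h where "h l = (if fst (prod_decode l) \<le> \<rho> l then fst (prod_decode l) else 0)" for l
  have fin: "finite (?A k)" for k by simp
  have ne: "?A k \<noteq> {}" for k using assms by auto
  have mem: "\<rho> k \<in> ?A k" for k unfolding \<rho>_def by (rule Max_in[OF fin ne])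
  have ge: "r \<le> \<rho> k" if "r \<le> k" "\<forall>i\<le>r. \<forall>R\<le>r. N i R \<le> k" for r k
    unfolding \<rho>_def by (rule Max_ge[OF fin]) (use that in auto)
  have mono: "mono \<rho>"
  proof (rule monoI)
    fix k k' :: nat assume "k \<le> k'"
    then show "\<rho> k \<le> \<rho> k'" using mem[of k] by (intro ge) (auto intro: order_trans)
  qed
  have unb: "\<exists>k. r \<le> \<rho> k" for r
  proof -
    let ?k = "max r (Max ((\<lambda>(i, R). N i R) ` ({..r} \<times> {..r})))"
    have "N i R \<le> ?k" if "i \<le> r" "R \<le> r" for i R
      by (rule max.coboundedI2, rule Max_ge) (use that in auto)
    then show ?thesis by (intro exI[of _ ?k] ge) auto
  qed
  have "\<exists>l\<ge>k. h l = i \<and> r \<le> \<rho> l" for i r k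
  proof -
    obtain k' where k': "max i r \<le> \<rho> k'" using unb by blast
    \<comment> \<open>The second component pushes the code beyond both \<open>k\<close> and
      \<open>k'\<close>, while the first selects \<open>i\<close>.\<close>
    let ?l = "prod_encode (i, max k k')"
    have l: "?l \<ge> max k k'" by (rule le_prod_encode_2)
    then have "max i r \<le> \<rho> ?l" using k' monoD[OF mono, of k' ?l] by linarith
    then show ?thesis using l by (intro exI[of _ ?l]) (auto simp: h_def)
  qed
  moreover have "h k \<le> \<rho> k" for k by (simp add: h_def)
  ultimately show ?thesis using that[of \<rho> h] mono mem by blast
qed

text \<open>At time \<open>spaced m\<close> the summands before the \<open>m\<close>-th are
  annihilated, the \<open>m\<close>-th has come down to its target, and the later ones add up to at
  most \<open>(1/2) ^ dyadic m\<close>. The targets are dense, and the times of a fixed valuation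
  have positive lower density.\<close>

lemma frequently_hypercyclic_of_tame_sequence:
  fixes T :: "(complex ^ 'd::finite \<Rightarrow> complex) \<Rightarrow> (complex ^ 'd \<Rightarrow> complex)"
    and s :: "nat \<Rightarrow> nat \<Rightarrow> complex ^ 'd \<Rightarrow> complex"
  assumes T: "bounded_operator T" and s: "\<And>i q. s i q \<in> entire"
    and Ts: "\<And>i q. T (s i (Suc q)) = s i q"
    and N0: "N 0 0 = 0"
    and nil: "\<And>i R n. N i R \<le> n \<Longrightarrow> (T ^^ n) (s i 0) = (\<lambda>z. 0)"
    and decay: "\<And>i R q z. N i R \<le> q \<Longrightarrow> z \<in> cball 0 (real R) \<Longrightarrow> cmod (s i q z) \<le> (1/2) ^ q"
    and dense: "\<And>g R e. g \<in> entire \<Longrightarrow> e > 0 \<Longrightarrow> \<exists>i. \<forall>z\<in>cball 0 R. cmod (s i 0 z - g z) < e"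
  shows "frequently_hypercyclic entire_topology T"
proof -
  obtain \<rho> h where \<rho>: "mono \<rho>" "\<And>k i R. i \<le> \<rho> k \<Longrightarrow> R \<le> \<rho> k \<Longrightarrow> N i R \<le> k"
    and h: "\<And>k. h k \<le> \<rho> k" "\<And>i r k. \<exists>l\<ge>k. h l = i \<and> r \<le> \<rho> l"
    using slow_indexing[of N, OF N0] by blast
  define c where "c n = s (h (dyadic n)) (spaced n)" for n
  define x where "x = (\<lambda>z. \<Sum>n. c n z)"
  \<comment> \<open>Since \<open>\<rho>\<close> is monotone, waiting for both the stage of the index
    and the stage of the radius meets the threshold.\<close>
  have Nle: "N (h k) R \<le> q" if "k \<le> q" "k' \<le> q" "R \<le> \<rho> k'" for k k' q R
    by (rule \<rho>(2)) (use that h(1)[of k] monoD[OF \<rho>(1), of k q] monoD[OF \<rho>(1), of k' q] in linarith)+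
  have shift: "(T ^^ q) (s i (q + r)) = s i r" for i q r
    by (induction q) (simp_all add: funpow_swap1 Ts)
  have c: "c n \<in> entire" for n by (simp add: c_def s)
  have lim: "econv (\<lambda>K z. \<Sum>n<K. 1 * c n z) x"
    unfolding econv_def
  proof
    fix R :: real
    obtain k where k: "nat \<lceil>R\<rceil> \<le> \<rho> k" using h(2) by blast
    \<comment> \<open>\<open>Suc k\<close> excludes \<open>n = 0\<close>, so that the gap from index
      0 carries \<open>spaced n\<close> past both stages \<open>k\<close> and
      \<open>dyadic n\<close>.\<close>
    have "cmod (c n z) \<le> (1/2) ^ n" if "n \<ge> Suc k" "z \<in> cball 0 R" for n z
    proof -
      have n: "n + dyadic n \<le> spaced n" using spaced_gap[of 0 n] that by simp
      have "cmod (c n z) \<le> (1/2) ^ spaced n"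
        unfolding c_def
        by (rule decay[OF Nle[OF _ _ k]]) (use n that in \<open>auto intro: order_trans[OF _ real_nat_ceiling_ge]\<close>)
      also have "\<dots> \<le> (1/2) ^ n" using n by (intro power_decreasing) auto
      finally show ?thesis .
    qed
    then have "\<forall>\<^sub>F n in sequentially. \<forall>z\<in>cball 0 R. cmod (c n z) \<le> (1/2) ^ n"
      unfolding eventually_sequentially by blast
    from Weierstrass_m_test_ev[OF this]
    show "uniform_limit (cball 0 R) (\<lambda>K z. \<Sum>n<K. 1 * c n z) x sequentially" by (simp add: x_def)
  qed
  have partial: "(\<lambda>z. \<Sum>n<K. 1 * c n z) \<in> entire" for K
    by (intro entire_sum entire_cmult c)
  have x: "x \<in> entire" by (rule econv_entire[OF partial lim])
  have close: "cmod ((T ^^ spaced m) x z - s (h (dyadic m)) 0 z) \<le> (1/2) ^ dyadic m"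
    if z: "z \<in> cball 0 (real (\<rho> (dyadic m)))" for m z
  proof -
    note Tm = bounded_operator_funpow[OF T, of "spaced m"]
    \<comment> \<open>The time elapsed since \<open>spaced n\<close> is at least
      \<open>dyadic n\<close>, long enough to annihilate the target reached then.\<close>
    have before: "(T ^^ spaced m) (c n) = (\<lambda>z. 0)" if "n < m" for n
    proof -
      have gap: "spaced n + dyadic n \<le> spaced m" using spaced_gap[OF that] by linarith
      have "(T ^^ spaced m) (c n) = (T ^^ (spaced m - spaced n)) ((T ^^ spaced n) (s (h (dyadic n)) (spaced n + 0)))"
        using gap by (simp add: c_def flip: funpow_add[unfolded o_def fun_eq_iff, rule_format])
      also have "\<dots> = (T ^^ (spaced m - spaced n)) (s (h (dyadic n)) 0)" by (simp only: shift)
      also have "\<dots> = (\<lambda>z. 0)"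
        by (rule nil[where R=0], rule Nle[of _ _ "dyadic n"]) (use gap in auto)
      finally show ?thesis .
    qed
    have at: "(T ^^ spaced m) (c m) = s (h (dyadic m)) 0"
      using shift[of "spaced m" "h (dyadic m)" 0] by (simp add: c_def)
    \<comment> \<open>The remaining distance on the backward orbit covers both valuations, so the
      decay holds on the ball of stage \<open>dyadic m\<close>.\<close>
    have after: "cmod ((T ^^ spaced m) (c n) z) \<le> (1/2) ^ (n - m + dyadic m)" if "m < n" for n
    proof -
      let ?q = "spaced n - spaced m"
      have gap: "n - m + dyadic m + dyadic n \<le> ?q" using spaced_gap[OF that] by linarith
      have "(T ^^ spaced m) (c n) = s (h (dyadic n)) ?q"
        using shift[of "spaced m" "h (dyadic n)" ?q] spaced_gap[OF that] by (simp add: c_def)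
      moreover have "cmod (s (h (dyadic n)) ?q z) \<le> (1/2) ^ ?q"
        by (rule decay[OF Nle[of _ _ "dyadic m"]]) (use gap z in auto)
      moreover have "(1/2 :: real) ^ ?q \<le> (1/2) ^ (n - m + dyadic m)"
        using gap by (intro power_decreasing) auto
      ultimately show ?thesis by (simp only: order_trans)
    qed
    \<comment> \<open>The first \<open>Suc m\<close> terms reproduce the target exactly;
      \<open>1 - (1/2) ^ j\<close> is the geometric sum bounding the next \<open>j\<close>
      terms.\<close>
    have bound: "cmod ((\<Sum>n<Suc m + j. (T ^^ spaced m) (c n) z) - s (h (dyadic m)) 0 z)
        \<le> (1/2) ^ dyadic m * (1 - (1/2) ^ j)" for j
    proof (induction j)
      case 0
      then show ?case by (simp add: before at)
    next
      case (Suc j)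
      have "cmod ((T ^^ spaced m) (c (Suc m + j)) z) \<le> (1/2) ^ dyadic m * (1/2) ^ Suc j"
        using after[of "Suc m + j"] by (simp add: power_add mult_ac)
      moreover have "(\<Sum>n<Suc m + Suc j. (T ^^ spaced m) (c n) z) - s (h (dyadic m)) 0 z
        = ((\<Sum>n<Suc m + j. (T ^^ spaced m) (c n) z) - s (h (dyadic m)) 0 z) + (T ^^ spaced m) (c (Suc m + j)) z"
        by simp
      ultimately have "cmod ((\<Sum>n<Suc m + Suc j. (T ^^ spaced m) (c n) z) - s (h (dyadic m)) 0 z)
        \<le> (1/2) ^ dyadic m * (1 - (1/2) ^ j) + (1/2) ^ dyadic m * (1/2) ^ Suc j"
        using Suc norm_triangle_mono by metis
      then show ?case by (simp add: algebra_simps)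
    qed
    have "econv (\<lambda>K. (T ^^ spaced m) (\<lambda>z. \<Sum>n<K. 1 * c n z)) ((T ^^ spaced m) x)"
      by (rule bounded_operator_econv[OF Tm partial x lim])
    moreover have "(T ^^ spaced m) (\<lambda>z. \<Sum>n<K. 1 * c n z) = (\<lambda>z. \<Sum>n<K. 1 * (T ^^ spaced m) (c n) z)" for K
      by (rule bounded_operator_sum[OF Tm c])
    ultimately have "(\<lambda>K. \<Sum>n<K. (T ^^ spaced m) (c n) z) \<longlonglongrightarrow> (T ^^ spaced m) x z"
      by (auto dest: econv_pointwise[of _ _ z])
    then have "(\<lambda>K. cmod ((\<Sum>n<K. (T ^^ spaced m) (c n) z) - s (h (dyadic m)) 0 z))
        \<longlonglongrightarrow> cmod ((T ^^ spaced m) x z - s (h (dyadic m)) 0 z)"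
      by (intro tendsto_intros)
    moreover have "cmod ((\<Sum>n<K. (T ^^ spaced m) (c n) z) - s (h (dyadic m)) 0 z) \<le> (1/2) ^ dyadic m"
      if "K \<ge> Suc m" for K
    proof -
      have "Suc m + (K - Suc m) = K" using that by simp
      then have "cmod ((\<Sum>n<K. (T ^^ spaced m) (c n) z) - s (h (dyadic m)) 0 z)
          \<le> (1/2) ^ dyadic m * (1 - (1/2) ^ (K - Suc m))"
        using bound[of "K - Suc m"] by (simp only:)
      also have "\<dots> \<le> (1/2) ^ dyadic m" by (simp add: mult_left_le)
      finally show ?thesis .
    qed
    ultimately show ?thesis by (intro LIMSEQ_le_const2) auto
  qed
  have "lower_density {n. (T ^^ n) x \<in> U} > 0" if U: "openin entire_topology U" "U \<noteq> {}" for U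
  proof -
    obtain g where g: "g \<in> U" using U(2) by blast
    have op: "entire_open U" using U(1) by (simp only: openin_entire_topology)
    have ge: "g \<in> entire" using entire_open_subset[OF op] g by blast
    obtain K e where K: "compact K" "e > 0" "{f \<in> entire. \<forall>z\<in>K. cmod (f z - g z) < e} \<subseteq> U"
      by (rule entire_openE[OF op g])
    obtain R where R: "K \<subseteq> cball 0 R"
      using bounded_subset_ballD[OF compact_imp_bounded[OF K(1)], of 0] ball_subset_cball by (meson order_trans)
    obtain i where i: "\<forall>z\<in>cball 0 R. cmod (s i 0 z - g z) < e / 2"
      using dense[OF ge, of "e / 2" R] K(2) by auto
    obtain k where k: "(1/2 :: real) ^ k < e / 2"
      using real_arch_pow_inv[of "e / 2" "1 / 2"] K(2) by auto
    \<comment> \<open>The valuation \<open>l\<close> has to select the approximating orbit and also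
      be large enough for the tolerance and for the radius.\<close>
    obtain l where l: "l \<ge> k" "h l = i" "nat \<lceil>R\<rceil> \<le> \<rho> l" using h(2) by blast
    have "(T ^^ spaced (2 ^ l * Suc (2 * t))) x \<in> U" for t
    proof -
      let ?m = "2 ^ l * Suc (2 * t)"
      have "cmod ((T ^^ spaced ?m) x z - g z) < e" if "z \<in> K" for z
      proof -
        have zR: "norm z \<le> R" using that R by auto
        then have "norm z \<le> real (\<rho> l)" using l(3) real_nat_ceiling_ge[of R] by linarith
        then have "cmod ((T ^^ spaced ?m) x z - s i 0 z) \<le> (1/2) ^ l"
          using close[of z ?m] by (simp only: dyadic_power_times_odd l(2) mem_cball_0)
        also have "\<dots> \<le> (1/2) ^ k" using l(1) by (intro power_decreasing) auto
        finally have "cmod ((T ^^ spaced ?m) x z - s i 0 z) < e / 2" using k by simp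
        moreover have "cmod (s i 0 z - g z) < e / 2" using i zR by simp
        ultimately show ?thesis
          using norm_triangle_ineq[of "(T ^^ spaced ?m) x z - s i 0 z" "s i 0 z - g z"] by simp
      qed
      then show ?thesis
        using K(3) bounded_operator_entire[OF bounded_operator_funpow[OF T] x] by blast
    qed
    moreover have "spaced (2 ^ l * Suc (2 * t)) \<le> (6 * 2 ^ l) * Suc t" for t
      by (rule order_trans[OF spaced_le]) (simp add: algebra_simps)
    moreover have "inj (\<lambda>t. spaced (2 ^ l * Suc (2 * t)))"
      by (rule injI) (auto dest!: injD[OF inj_spaced])
    ultimately show ?thesis by (intro lower_density_pos[where f="\<lambda>t. spaced (2 ^ l * Suc (2 * t))"]) auto
  qed
  then show ?thesis
    unfolding frequently_hypercyclic_def topspace_entire_topology using x by blast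
qed

section \<open>Backward orbits and density\<close>

text \<open>The rate 1/4 with a free constant eventually beats \<open>(1/2) ^ q\<close> without a
  constant, and it is stable under linear combinations.\<close>

definition decaying_backward_orbit ::
    "((complex ^ 'd::finite \<Rightarrow> complex) \<Rightarrow> (complex ^ 'd \<Rightarrow> complex)) \<Rightarrow>
      (nat \<Rightarrow> complex ^ 'd \<Rightarrow> complex) \<Rightarrow> bool" where
  "decaying_backward_orbit T s \<longleftrightarrow>
     (\<forall>q. s q \<in> entire) \<and> (\<forall>q. T (s (Suc q)) = s q) \<and>
     (\<exists>N. \<forall>n\<ge>N. (T ^^ n) (s 0) = (\<lambda>z. 0)) \<and>
     (\<forall>R. \<exists>B. \<forall>q. \<forall>z\<in>cball 0 R. cmod (s q z) \<le> B * (1/4) ^ q)"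

lemma decaying_backward_orbitD:
  assumes "decaying_backward_orbit T s"
  shows "s q \<in> entire" "T (s (Suc q)) = s q"
    and "\<exists>N. \<forall>n\<ge>N. (T ^^ n) (s 0) = (\<lambda>z. 0)"
    and "\<exists>B. \<forall>q. \<forall>z\<in>cball 0 R. cmod (s q z) \<le> B * (1/4) ^ q"
  using assms unfolding decaying_backward_orbit_def by blast+

lemma decaying_backward_orbit_zero:
  assumes "bounded_operator T"
  shows "decaying_backward_orbit T (\<lambda>q z. 0)"
  unfolding decaying_backward_orbit_def
proof (intro conjI allI)
  show "\<exists>N. \<forall>n\<ge>N. (T ^^ n) (\<lambda>z. 0) = (\<lambda>z. 0)"
    by (simp add: bounded_operator_zero[OF bounded_operator_funpow[OF assms]])
  show "\<exists>B. \<forall>q. \<forall>z\<in>cball 0 R. cmod 0 \<le> B * (1/4) ^ q" for R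
    by (rule exI[of _ 0]) simp
qed (simp_all add: bounded_operator_zero[OF assms])

lemma decaying_backward_orbit_add_cmult:
  assumes T: "bounded_operator T" and s: "decaying_backward_orbit T s" and t: "decaying_backward_orbit T t"
  shows "decaying_backward_orbit T (\<lambda>q z. s q z + c * t q z)"
proof -
  note D = decaying_backward_orbitD
  have lin: "(T ^^ n) (\<lambda>z. f z + c * g z) = (\<lambda>z. (T ^^ n) f z + c * (T ^^ n) g z)"
    if "f \<in> entire" "g \<in> entire" for n f g
    using bounded_operator_add[OF bounded_operator_funpow[OF T] that(1) entire_cmult[OF that(2)]]
      bounded_operator_cmult[OF bounded_operator_funpow[OF T] that(2)] by simp
  obtain N N' where "\<forall>n\<ge>N. (T ^^ n) (s 0) = (\<lambda>z. 0)" "\<forall>n\<ge>N'. (T ^^ n) (t 0) = (\<lambda>z. 0)"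
    using D(3)[OF s] D(3)[OF t] by blast
  then have "\<forall>n\<ge>max N N'. (T ^^ n) (\<lambda>z. s 0 z + c * t 0 z) = (\<lambda>z. 0)"
    by (simp add: lin[OF D(1)[OF s] D(1)[OF t]])
  moreover have "\<exists>B. \<forall>q. \<forall>z\<in>cball 0 R. cmod (s q z + c * t q z) \<le> B * (1/4) ^ q" for R
  proof -
    obtain B B' where B: "\<And>q z. z\<in>cball 0 R \<Longrightarrow> cmod (s q z) \<le> B * (1/4) ^ q"
      "\<And>q z. z\<in>cball 0 R \<Longrightarrow> cmod (t q z) \<le> B' * (1/4) ^ q"
      using D(4)[OF s, of R] D(4)[OF t, of R] by blast
    have "cmod (s q z + c * t q z) \<le> (B + cmod c * B') * (1/4) ^ q" if "z \<in> cball 0 R" for q z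
    proof -
      have "cmod (s q z + c * t q z) \<le> cmod (s q z) + cmod c * cmod (t q z)"
        using norm_triangle_ineq[of "s q z" "c * t q z"] by (simp add: norm_mult)
      also have "\<dots> \<le> B * (1/4) ^ q + cmod c * (B' * (1/4) ^ q)"
        using that by (intro add_mono mult_left_mono B) auto
      finally show ?thesis by (simp only: distrib_right mult.assoc)
    qed
    then show ?thesis by blast
  qed
  moreover have "T (\<lambda>z. s (Suc q) z + c * t (Suc q) z) = (\<lambda>z. s q z + c * t q z)" for q
    using lin[OF D(1)[OF s] D(1)[OF t], of 1] by (simp add: D(2)[OF s] D(2)[OF t])
  moreover have "(\<lambda>z. s q z + c * t q z) \<in> entire" for q
    by (intro entire_add entire_cmult D(1)[OF s] D(1)[OF t])
  ultimately show ?thesis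
    unfolding decaying_backward_orbit_def by blast
qed

lemma frequently_hypercyclic_criterion:
  fixes T :: "(complex ^ 'd::finite \<Rightarrow> complex) \<Rightarrow> (complex ^ 'd \<Rightarrow> complex)"
  assumes T: "bounded_operator T" and C: "countable C" "C \<noteq> {}"
    and orbit: "\<And>y. y \<in> C \<Longrightarrow> \<exists>s. s 0 = y \<and> decaying_backward_orbit T s"
    and dense: "\<And>g R e. g \<in> entire \<Longrightarrow> e > 0 \<Longrightarrow> \<exists>h\<in>C. \<forall>z\<in>cball 0 R. cmod (h z - g z) < e"
  shows "frequently_hypercyclic entire_topology T"
proof -
  obtain S where S: "\<And>y. y \<in> C \<Longrightarrow> S y 0 = y \<and> decaying_backward_orbit T (S y)"
    using orbit by metis
  \<comment> \<open>Index 0 holds the zero orbit, whose thresholds can all be 0; this supplies the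
    requirement \<open>N 0 0 = 0\<close>.\<close>
  define s where "s i = (case i of 0 \<Rightarrow> (\<lambda>q z. 0) | Suc i \<Rightarrow> S (from_nat_into C i))" for i
  have s: "decaying_backward_orbit T (s i)" for i
    using S from_nat_into[OF C(2)] decaying_backward_orbit_zero[OF T]
    by (auto simp: s_def split: nat.split)
  have "\<exists>N. (\<forall>n\<ge>N. (T ^^ n) (s i 0) = (\<lambda>z. 0)) \<and>
      (\<forall>q\<ge>N. \<forall>z\<in>cball 0 (real R). cmod (s i q z) \<le> (1/2) ^ q) \<and> (i = 0 \<longrightarrow> N = 0)" for i R
  proof (cases "i = 0")
    case True
    then show ?thesis
      using bounded_operator_zero[OF bounded_operator_funpow[OF T]] by (simp add: s_def)
  next
    case False
    obtain N where N: "\<forall>n\<ge>N. (T ^^ n) (s i 0) = (\<lambda>z. 0)"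
      using decaying_backward_orbitD(3)[OF s] by blast
    obtain B where B: "\<And>q z. z \<in> cball 0 (real R) \<Longrightarrow> cmod (s i q z) \<le> B * (1/4) ^ q"
      using decaying_backward_orbitD(4)[OF s, of "real R"] by blast
    obtain k where k: "B < 2 ^ k" using real_arch_pow[of 2 B] by auto
    have "cmod (s i q z) \<le> (1/2) ^ q" if "q \<ge> k" "z \<in> cball 0 (real R)" for q z
    proof -
      have "B * (1/4) ^ q \<le> 2 ^ q * (1/4) ^ q"
        using order_trans[OF less_imp_le[OF k] power_increasing[OF that(1)]] by (intro mult_right_mono) auto
      also have "\<dots> = (1/2) ^ q" by (simp flip: power_mult_distrib)
      finally show ?thesis using B[OF that(2), of q] by linarith
    qed
    then show ?thesis using N False by (intro exI[of _ "max N k"]) auto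
  qed
  then obtain N where N: "\<And>i R n. N i R \<le> n \<Longrightarrow> (T ^^ n) (s i 0) = (\<lambda>z. 0)"
    "\<And>i R q z. N i R \<le> q \<Longrightarrow> z \<in> cball 0 (real R) \<Longrightarrow> cmod (s i q z) \<le> (1/2) ^ q"
    "\<And>i R. i = 0 \<Longrightarrow> N i R = 0"
    by metis
  show ?thesis
  proof (rule frequently_hypercyclic_of_tame_sequence[OF T, of s N, OF decaying_backward_orbitD(1)[OF s]
        decaying_backward_orbitD(2)[OF s] N(3)[OF refl] N(1) N(2)])
    fix g :: "complex ^ 'd \<Rightarrow> complex" and R e :: real assume "g \<in> entire" "e > 0"
    then obtain y where y: "y \<in> C" "\<forall>z\<in>cball 0 R. cmod (y z - g z) < e" using dense by blast
    obtain i where i: "from_nat_into C i = y" using from_nat_into_surj[OF C(1) y(1)] by blast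
    then have "s (Suc i) 0 = y" using S y(1) by (simp add: s_def)
    then show "\<exists>i. \<forall>z\<in>cball 0 R. cmod (s i 0 z - g z) < e"
      using y(2) by (intro exI[of _ "Suc i"]) simp
  qed
qed

lemma ladder_backward_orbit:
  assumes T: "bounded_operator T" and a: "a \<noteq> 0"
    and comm: "\<And>f. f \<in> entire \<Longrightarrow> T (ddir v f) = (\<lambda>z. ddir v (T f) z + a * f z)"
    and g: "g \<in> entire" and Tg: "T g = (\<lambda>z. 0)"
  shows "\<exists>s. s 0 = (ddir v ^^ m) g \<and> decaying_backward_orbit T s"
proof -
  let ?D = "\<lambda>n. (ddir v ^^ n) g"
  have D: "?D n \<in> entire" for n by (rule ddir_funpow_entire[OF g])
  \<comment> \<open>Moving \<open>T\<close> past each derivative contributes one \<open>a\<close>;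
    what remains is \<open>T g = 0\<close>.\<close>
  have lower: "T (?D (Suc n)) = (\<lambda>z. of_nat (Suc n) * a * ?D n z)" for n
  proof (induction n)
    case 0
    then show ?case using comm[OF g] by (simp add: Tg)
  next
    case (Suc n)
    have "T (?D (Suc (Suc n))) = (\<lambda>z. ddir v (T (?D (Suc n))) z + a * ?D (Suc n) z)"
      using comm[OF D[of "Suc n"]] by simp
    also have "ddir v (T (?D (Suc n))) = (\<lambda>z. of_nat (Suc n) * a * ?D (Suc n) z)"
      unfolding Suc ddir_cmult[OF D] by simp
    finally show ?case by (simp add: algebra_simps)
  qed
  \<comment> \<open>After \<open>m\<close> applications a multiple of \<open>g\<close> is left, and
    one more gives 0.\<close>
  have nil: "(T ^^ (Suc m + n)) (?D m) = (\<lambda>z. 0)" for m n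
  proof (induction m)
    case 0
    then show ?case
      by (simp add: funpow_swap1 Tg bounded_operator_zero[OF bounded_operator_funpow[OF T]])
  next
    case (Suc m)
    have "(T ^^ (Suc (Suc m) + n)) (?D (Suc m)) = (T ^^ (Suc m + n)) (T (?D (Suc m)))"
      by (simp only: add_Suc funpow_Suc_right o_def)
    then show ?case
      by (simp only: lower bounded_operator_cmult[OF bounded_operator_funpow[OF T] D] Suc) simp
  qed
  \<comment> \<open>The denominators cancel the factors \<open>(m + i) * a\<close>,
    \<open>1 \<le> i \<le> q\<close>, collected while descending from order \<open>m + q\<close> to
    order \<open>m\<close>.\<close>
  define s where "s q = (\<lambda>z. fact m / (a ^ q * fact (m + q)) * ?D (m + q) z)" for q
  have "T (s (Suc q)) = s q" for q
  proof -
    have "T (s (Suc q)) = (\<lambda>z. fact m / (a ^ Suc q * fact (m + Suc q)) * T (?D (Suc (m + q))) z)"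
      unfolding s_def by (simp only: bounded_operator_cmult[OF T D] add_Suc_right)
    moreover have "fact m / (a ^ Suc q * fact (m + Suc q)) * (of_nat (Suc (m + q)) * a) = fact m / (a ^ q * fact (m + q))"
    proof -
      have "fact (m + Suc q) = (of_nat (Suc (m + q)) * fact (m + q) :: complex)" by (simp only: add_Suc_right fact_Suc)
      moreover have "of_nat (Suc (m + q)) \<noteq> (0 :: complex)" by (simp only: of_nat_eq_0_iff)
      ultimately show ?thesis using a by (simp del: of_nat_Suc)
    qed
    ultimately show ?thesis unfolding lower s_def by (simp add: mult.assoc[symmetric])
  qed
  moreover have "\<exists>N. \<forall>n\<ge>N. (T ^^ n) (s 0) = (\<lambda>z. 0)"
  proof (intro exI allI impI)
    fix n assume "Suc m \<le> n"
    then show "(T ^^ n) (s 0) = (\<lambda>z. 0)" using nil[of m "n - Suc m"] by (simp add: s_def)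
  qed
  moreover have "\<exists>B. \<forall>q. \<forall>z\<in>cball 0 R. cmod (s q z) \<le> B * (1/4) ^ q" for R
  proof -
    \<comment> \<open>Cauchy's factorial cancels the one in \<open>s q\<close>, leaving powers of
      \<open>cmod a * r\<close>; this radius makes the rate 1/4.\<close>
    define r where "r = 4 / cmod a"
    have r: "r > 0" "cmod a * r = 4" using a by (auto simp: r_def)
    obtain B where B: "\<forall>z\<in>cball 0 (R + r * norm v). cmod (g z) \<le> B"
      using entire_bounded_on_cball[OF g] by blast
    have "cmod (s q z) \<le> fact m * B / r ^ m * (1/4) ^ q" if z: "z \<in> cball 0 R" for q z
    proof -
      have "cmod (s q z) = fact m / (cmod a ^ q * fact (m + q)) * cmod (?D (m + q) z)"
        by (simp add: s_def norm_mult norm_divide norm_power)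
      also have "\<dots> \<le> fact m / (cmod a ^ q * fact (m + q)) * (fact (m + q) * B / r ^ (m + q))"
        by (intro mult_left_mono ddir_funpow_bound[OF g r(1) B z]) auto
      also have "\<dots> = fact m * B / (r ^ m * (cmod a * r) ^ q)"
        by (simp add: power_add power_mult_distrib)
      finally show ?thesis by (simp add: r(2) power_divide)
    qed
    then show ?thesis by blast
  qed
  moreover have "s q \<in> entire" for q unfolding s_def by (intro entire_cmult D)
  moreover have "s 0 = ?D m" by (simp add: s_def)
  ultimately show ?thesis unfolding decaying_backward_orbit_def by blast
qed

section \<open>Linear spans with restricted coefficients\<close>

inductive_set lin_span :: "complex set \<Rightarrow> ('a \<Rightarrow> complex) set \<Rightarrow> ('a \<Rightarrow> complex) set" for Q W where
  zero: "(\<lambda>z. 0) \<in> lin_span Q W"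
| step: "p \<in> lin_span Q W \<Longrightarrow> c \<in> Q \<Longrightarrow> y \<in> W \<Longrightarrow> (\<lambda>z. p z + c * y z) \<in> lin_span Q W"

lemma countable_lin_span:
  assumes "countable Q" "countable W"
  shows "countable (lin_span Q W)"
proof (rule countable_subset)
  let ?f = "\<lambda>xs. foldr (\<lambda>(c, y) p z. p z + c * y z) xs (\<lambda>z. 0)"
  show "lin_span Q W \<subseteq> ?f ` lists (Q \<times> W)"
  proof
    fix p assume "p \<in> lin_span Q W"
    then show "p \<in> ?f ` lists (Q \<times> W)"
    proof induction
      case zero
      show ?case by (rule image_eqI[of _ _ "[]"]) auto
    next
      case (step p c y)
      then obtain xs where "xs \<in> lists (Q \<times> W)" "p = ?f xs" by blast
      then show ?case using step(2,3) by (intro image_eqI[of _ _ "(c, y) # xs"]) auto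
    qed
  qed
  show "countable (?f ` lists (Q \<times> W))" using assms by blast
qed

lemma lin_span_base: "y \<in> W \<Longrightarrow> 1 \<in> Q \<Longrightarrow> y \<in> lin_span Q W"
  using lin_span.step[OF lin_span.zero, of 1 Q y W] by simp

lemma lin_span_add:
  assumes "p \<in> lin_span Q W" "h \<in> lin_span Q W"
  shows "(\<lambda>z. p z + h z) \<in> lin_span Q W"
  using assms(1)
proof induction
  case (step p c y)
  then show ?case using lin_span.step[of "\<lambda>z. p z + h z" Q W c y] by (simp add: algebra_simps)
qed (use assms in simp)

lemma lin_span_cmult:
  assumes "p \<in> lin_span UNIV W"
  shows "(\<lambda>z. c * p z) \<in> lin_span UNIV W"
  using assms
proof induction
  case (step p d y)
  then show ?case using lin_span.step[of "\<lambda>z. c * p z" UNIV W "c * d" y] by (simp add: algebra_simps)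
qed (simp add: lin_span.zero)

lemma lin_span_entire:
  assumes "W \<subseteq> entire" "p \<in> lin_span Q W" shows "p \<in> entire"
  using assms(2) by induction (use assms(1) in \<open>auto intro!: entire_add entire_cmult\<close>)

lemma lin_span_operator:
  assumes T: "bounded_operator T" and W: "W \<subseteq> entire" and TW: "\<And>y. y \<in> W \<Longrightarrow> T y \<in> lin_span UNIV W"
    and p: "p \<in> lin_span UNIV W"
  shows "T p \<in> lin_span UNIV W"
  using p
proof induction
  case (step p c y)
  then have "T (\<lambda>z. p z + c * y z) = (\<lambda>z. T p z + c * T y z)"
    using W lin_span_entire[OF W step(1)]
    by (simp add: bounded_operator_add[OF T] bounded_operator_cmult[OF T] entire_cmult subset_iff)
  then show ?case using step TW by (simp add: lin_span_add lin_span_cmult)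
qed (simp add: bounded_operator_zero[OF T] lin_span.zero)

text \<open>The coefficients are replaced one at a time, half of the tolerance going to the current
  term and half to the rest of the sum.\<close>

lemma lin_span_dense_coefficients:
  assumes W: "W \<subseteq> entire" and p: "p \<in> lin_span UNIV W" and e: "e > 0"
    and Q: "\<And>X. open X \<Longrightarrow> X \<noteq> {} \<Longrightarrow> \<exists>c\<in>Q. c \<in> X"
  shows "\<exists>h\<in>lin_span Q W. \<forall>z\<in>cball 0 R. cmod (h z - p z) < e"
  using p e
proof (induction arbitrary: e)
  case zero
  then show ?case by (intro bexI[of _ "\<lambda>z. 0"] lin_span.zero) simp
next
  case (step p c y)
  obtain h where h: "h \<in> lin_span Q W" "\<forall>z\<in>cball 0 R. cmod (h z - p z) < e / 2"
    using step.IH[of "e / 2"] step.prems by auto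
  obtain B where B: "B > 0" "\<forall>z\<in>cball 0 R. cmod (y z) \<le> B"
    using entire_bounded_on_cball W step(3) by blast
  obtain q where q: "q \<in> Q" "dist c q < e / (2 * B)"
    using Q[of "ball c (e / (2 * B))"] divide_pos_pos[OF step.prems, of "2 * B"] B(1) by auto
  have "cmod (h z + q * y z - (p z + c * y z)) < e" if z: "z \<in> cball 0 R" for z
  proof -
    have "cmod ((q - c) * y z) \<le> e / (2 * B) * B"
      unfolding norm_mult using q(2) B z step.prems by (intro mult_mono) (auto simp: dist_norm norm_minus_commute)
    moreover have "cmod (h z - p z) < e / 2" using h z by blast
    ultimately have "cmod ((h z - p z) + (q - c) * y z) < e"
      using norm_triangle_ineq[of "h z - p z" "(q - c) * y z"] B(1) by simp
    then show ?thesis by (simp add: algebra_simps)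
  qed
  then show ?case by (intro bexI[OF _ lin_span.step[OF h(1) q(1) step(3)]] ballI)
qed

text \<open>Closure by approximation on balls instead of limits of sequences: a limit of closure
  points is then handled by one triangle inequality, without a diagonal sequence.\<close>

definition entire_closure :: "(complex ^ 'd::finite \<Rightarrow> complex) set \<Rightarrow> (complex ^ 'd \<Rightarrow> complex) set" where
  "entire_closure A = {g \<in> entire. \<forall>R e. e > 0 \<longrightarrow> (\<exists>h\<in>A. \<forall>z\<in>cball 0 R. cmod (h z - g z) < e)}"

lemma entire_closureI:
  assumes "g \<in> entire" "\<And>R e. e > 0 \<Longrightarrow> \<exists>h\<in>A. \<forall>z\<in>cball 0 R. cmod (h z - g z) < e"
  shows "g \<in> entire_closure A"
  using assms unfolding entire_closure_def by simp

lemma entire_closure_superset: "A \<subseteq> entire \<Longrightarrow> A \<subseteq> entire_closure A"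
proof
  fix g assume "A \<subseteq> entire" "g \<in> A"
  then show "g \<in> entire_closure A" by (intro entire_closureI bexI[of _ g]) auto
qed

lemma entire_closureE:
  assumes "g \<in> entire_closure A" "e > 0"
  obtains h where "h \<in> A" "\<And>z. z \<in> cball 0 R \<Longrightarrow> cmod (h z - g z) < e"
  using assms unfolding entire_closure_def by blast

lemma entire_closure_operator:
  assumes T: "bounded_operator T" and A: "A \<subseteq> entire" "\<And>h. h \<in> A \<Longrightarrow> T h \<in> A" and g: "g \<in> entire_closure A"
  shows "T g \<in> entire_closure A"
proof -
  have ge: "g \<in> entire" using g unfolding entire_closure_def by blast
  have "\<exists>h\<in>A. \<forall>z\<in>cball 0 R. cmod (h z - T g z) < e" if e: "e > 0" for R e
  proof -
    obtain C R' where 1: "C > 0" "\<And>f B z. f \<in> entire \<Longrightarrow> B \<ge> 0 \<Longrightarrow> (\<And>z. z \<in> cball 0 R' \<Longrightarrow> cmod (f z) \<le> B) \<Longrightarrow>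
      z \<in> cball 0 R \<Longrightarrow> cmod (T f z) \<le> C * B" using T by (rule bounded_operator_bound) blast
    obtain h where h: "h \<in> A" "\<And>z. z \<in> cball 0 R' \<Longrightarrow> cmod (h z - g z) < e / (2 * C)"
      by (rule entire_closureE[where e="e / (2 * C)" and R=R', OF g]) (use e 1(1) in auto)
    have he: "h \<in> entire" using h A by blast
    have "cmod (T h z - T g z) < e" if "z \<in> cball 0 R" for z
    proof -
      have "cmod (T (\<lambda>z. h z - g z) z) \<le> C * (e / (2 * C))"
        by (rule 1(2)[OF entire_diff[OF he ge] _ less_imp_le[OF h(2)] that]) (use e 1(1) in auto)
      then show ?thesis using e 1(1) by (simp add: bounded_operator_diff[OF T he ge])
    qed
    then show ?thesis by (intro bexI[OF _ A(2)[OF h(1)]] ballI)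
  qed
  then show ?thesis by (rule entire_closureI[OF bounded_operator_entire[OF T ge]])
qed

lemma entire_closed_subspace_closure:
  assumes W: "W \<subseteq> entire"
  shows "entire_closed_subspace (entire_closure (lin_span UNIV W))"
    (is "entire_closed_subspace ?M")
proof -
  let ?A = "lin_span UNIV W"
  have A: "?A \<subseteq> entire" using lin_span_entire[OF W] by blast
  have ME: "g \<in> entire" if "g \<in> ?M" for g using that unfolding entire_closure_def by blast
  have add: "(\<lambda>z. f z + g z) \<in> ?M" if f: "f \<in> ?M" and g: "g \<in> ?M" for f g
  proof -
    have "\<exists>h\<in>?A. \<forall>z\<in>cball 0 R. cmod (h z - (f z + g z)) < e" if "e > 0" for R e
    proof -
      have e: "e / 2 > 0" using that by simp
      obtain h where h: "h \<in> ?A" "\<And>z. z \<in> cball 0 R \<Longrightarrow> cmod (h z - f z) < e / 2" 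
        by (rule entire_closureE[where R=R, OF f e]) blast
      obtain h' where h': "h' \<in> ?A" "\<And>z. z \<in> cball 0 R \<Longrightarrow> cmod (h' z - g z) < e / 2" 
        by (rule entire_closureE[where R=R, OF g e]) blast
      have "cmod (h z + h' z - (f z + g z)) < e" if "z \<in> cball 0 R" for z
      proof -
        have "cmod (h z + h' z - (f z + g z)) \<le> cmod (h z - f z) + cmod (h' z - g z)"
          unfolding add_diff_add by (rule norm_triangle_ineq)
        then show ?thesis using h(2)[OF that] h'(2)[OF that] by linarith
      qed
      then show ?thesis by (intro bexI[OF _ lin_span_add[OF h(1) h'(1)]] ballI)
    qed
    then show ?thesis by (rule entire_closureI[OF entire_add[OF ME[OF f] ME[OF g]]])
  qed
  have scale: "(\<lambda>z. c * f z) \<in> ?M" if f: "f \<in> ?M" for f c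
  proof -
    have "\<exists>h\<in>?A. \<forall>z\<in>cball 0 R. cmod (h z - c * f z) < e" if "e > 0" for R e
    proof -
      have c: "cmod c + 1 > 0" using norm_ge_zero[of c] by linarith
      have e: "e / (cmod c + 1) > 0" by (rule divide_pos_pos[OF that c])
      obtain h where h: "h \<in> ?A" "\<And>z. z \<in> cball 0 R \<Longrightarrow> cmod (h z - f z) < e / (cmod c + 1)" 
        by (rule entire_closureE[where R=R, OF f e]) blast
      have "cmod (c * h z - c * f z) < e" if "z \<in> cball 0 R" for z
      proof -
        have "cmod (c * h z - c * f z) = cmod c * cmod (h z - f z)"
          by (simp add: right_diff_distrib flip: norm_mult)
        also have "\<dots> \<le> cmod c * (e / (cmod c + 1))"
          using h(2)[OF that] by (intro mult_left_mono) auto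
        also have "\<dots> < e" using \<open>e > 0\<close> c by (simp add: field_simps)
        finally show ?thesis .
      qed
      then show ?thesis by (intro bexI[OF _ lin_span_cmult[OF h(1)]] ballI)
    qed
    then show ?thesis by (rule entire_closureI[OF entire_cmult[OF ME[OF f]]])
  qed
  have lim: "g \<in> ?M" if F: "\<forall>n. F n \<in> ?M" and g: "econv F g" for F g
  proof -
    have "\<exists>h\<in>?A. \<forall>z\<in>cball 0 R. cmod (h z - g z) < e" if "e > 0" for R e
    proof -
      have e: "e / 2 > 0" using that by simp
      have "\<forall>\<^sub>F n in sequentially. \<forall>z\<in>cball 0 R. dist (F n z) (g z) < e / 2"
        using g e unfolding econv_def by (intro uniform_limitD) auto
      then obtain n where n: "\<And>z. z \<in> cball 0 R \<Longrightarrow> dist (F n z) (g z) < e / 2"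
        unfolding eventually_sequentially by blast
      obtain h where h: "h \<in> ?A" "\<And>z. z \<in> cball 0 R \<Longrightarrow> cmod (h z - F n z) < e / 2" 
        by (rule entire_closureE[where R=R, OF F[rule_format] e]) blast
      have "cmod (h z - g z) < e" if "z \<in> cball 0 R" for z
        using norm_triangle_ineq[of "h z - F n z" "F n z - g z"] h(2)[OF that] n[OF that]
        by (simp add: dist_norm)
      then show ?thesis by (intro bexI[OF _ h(1)] ballI)
    qed
    moreover have "g \<in> entire" by (rule econv_entire[OF ME g]) (use F in blast)
    ultimately show ?thesis by (rule entire_closureI[rotated])
  qed
  have "(\<lambda>z. 0) \<in> ?M" using entire_closure_superset[OF A] lin_span.zero by blast
  then show ?thesis unfolding entire_closed_subspace_def using ME add scale lim by blast
qed

section \<open>Application to the derivatives of a common kernel vector\<close>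

lemma ddir_funpow_commute:
  assumes "g \<in> entire"
  shows "ddir u ((ddir v ^^ m) g) = (ddir v ^^ m) (ddir u g)"
proof (induction m)
  case (Suc m)
  then show ?case using ddir_commute[OF ddir_funpow_entire[OF assms, where v=v and n=m], of u v] by simp
qed simp

theorem theorem1p1:
  fixes T :: "'d::finite \<Rightarrow> (complex ^ 'd \<Rightarrow> complex) \<Rightarrow> (complex ^ 'd \<Rightarrow> complex)"
    and a :: "'d \<Rightarrow> complex"
  assumes "\<And>j. continuous_linear_operator (T j)"
    and "(\<Inter>j. op_kernel (T j)) \<noteq> {\<lambda>z. 0}"
    and "\<And>j. a j \<noteq> 0"
    and "\<And>j k f. f \<in> entire \<Longrightarrow>
           commutator (T j) (pderiv_at k) f = (\<lambda>z. (if j = k then a j else 0) * f z)"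
  shows "\<forall>j. frequently_hypercyclic entire_topology (T j)"
proof
  fix j
  have T: "bounded_operator (T k)" for k by (rule continuous_linear_operator_imp_bounded[OF assms(1)])
  have comm: "T i (pderiv_at k f) = (\<lambda>z. pderiv_at k (T i f) z + (if i = k then a i else 0) * f z)"
    if "f \<in> entire" for i k f
    using assms(4)[OF that, of i k] unfolding commutator_def fun_eq_iff
    by (metis add.commute diff_add_cancel)
  \<comment> \<open>As 0 lies in every kernel, an intersection different from the singleton of 0
    must contain a nonzero function.\<close>
  have "(\<lambda>z. 0) \<in> (\<Inter>j. op_kernel (T j))"
    by (simp add: op_kernel_def bounded_operator_zero[OF T])
  then obtain f where "f \<in> (\<Inter>j. op_kernel (T j))" "f \<noteq> (\<lambda>z. 0)" using assms(2) by blast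
  then obtain u where f: "f \<in> entire" "\<And>k. T k f = (\<lambda>z. 0)" "f u \<noteq> 0"
    unfolding op_kernel_def by blast
  \<comment> \<open>The generators are indexed by words over the finite index type, which later
    yields countability.\<close>
  define W where "W = range (\<lambda>ws. foldr pderiv_at ws f)"
  have Wf: "f \<in> W" unfolding W_def by (rule image_eqI[of _ _ "[]"]) auto
  have DW: "pderiv_at k y \<in> W" if y: "y \<in> W" for k y
  proof -
    obtain ws where "y = foldr pderiv_at ws f" using y unfolding W_def by blast
    then show ?thesis unfolding W_def by (intro image_eqI[of _ _ "k # ws"]) auto
  qed
  have W_induct: "P y" if "y \<in> W" "P f" "\<And>y k. y \<in> W \<Longrightarrow> P y \<Longrightarrow> P (pderiv_at k y)" for P y
  proof -
    have "foldr pderiv_at ws f \<in> W \<and> P (foldr pderiv_at ws f)" for ws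
      by (induction ws) (use Wf DW that in auto)
    then show ?thesis using that(1) unfolding W_def by blast
  qed
  have We: "W \<subseteq> entire"
  proof
    fix y assume "y \<in> W"
    then show "y \<in> entire" by (rule W_induct) (auto intro: f pderiv_at_entire)
  qed
  have We': "lin_span UNIV W \<subseteq> entire" using lin_span_entire[OF We] by blast
  have D: "pderiv_at k p \<in> lin_span UNIV W" if "p \<in> lin_span UNIV W" for k p
  proof -
    have "ddir (axis k 1) p \<in> lin_span UNIV W"
    proof (rule lin_span_operator[OF bounded_operator_ddir We _ that])
      fix y assume y: "y \<in> W"
      then have "pderiv_at k y \<in> lin_span UNIV W" by (intro lin_span_base DW) auto
      then show "ddir (axis k 1) y \<in> lin_span UNIV W" using y We pderiv_at_eq_ddir[of y k] by auto
    qed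
    then show ?thesis using that We' by (metis pderiv_at_eq_ddir subsetD)
  qed
  \<comment> \<open>Induction on the word: applying \<open>T k\<close> to a derivative of
    \<open>y\<close> gives the derivative of \<open>T k y\<close> plus a multiple of
    \<open>y\<close>.\<close>
  have TW: "T k y \<in> lin_span UNIV W" if "y \<in> W" for k y
    using that
  proof (rule W_induct)
    show "T k f \<in> lin_span UNIV W" by (simp add: f lin_span.zero)
    fix y l assume y: "y \<in> W" "T k y \<in> lin_span UNIV W"
    have "y \<in> entire" using y We by blast
    then show "T k (pderiv_at l y) \<in> lin_span UNIV W"
      using lin_span.step[OF D[OF y(2)] UNIV_I y(1)] by (simp only: comm)
  qed
  let ?M = "entire_closure (lin_span UNIV W)"
  have M: "entire_closed_subspace ?M" by (rule entire_closed_subspace_closure[OF We])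
  have "?M = entire"
  proof (rule ladder_invariant_subspace_eq_entire[OF T assms(3) comm M])
    fix g k assume g: "g \<in> ?M"
    have ge: "g \<in> entire" using entire_closed_subspaceD(1)[OF M g] .
    have "ddir (axis k 1) g \<in> ?M"
      by (rule entire_closure_operator[OF bounded_operator_ddir We' _ g])
        (use D We' in \<open>metis pderiv_at_eq_ddir subsetD\<close>)
    then show "pderiv_at k g \<in> ?M" by (simp add: pderiv_at_eq_ddir[OF ge])
    show "T k g \<in> ?M"
      by (rule entire_closure_operator[OF T We' _ g], rule lin_span_operator[OF T We TW])
  next
    show "f \<in> ?M" using lin_span_base[OF Wf, of UNIV] entire_closure_superset[OF We'] by auto
  qed (use f in auto)
  \<comment> \<open>Dense coefficients keep the span dense, countable ones make it
    countable.\<close>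
  obtain Q :: "complex set" where Q: "countable Q" "\<And>X. open X \<Longrightarrow> X \<noteq> {} \<Longrightarrow> \<exists>c\<in>Q. c \<in> X"
    using countable_dense_setE by blast
  show "frequently_hypercyclic entire_topology (T j)"
  proof (rule frequently_hypercyclic_criterion[OF T, of "lin_span Q W"])
    have "countable (UNIV :: 'd list set)"
      using countable_lists[of "UNIV :: 'd set"] by (simp add: countable_finite)
    then show "countable (lin_span Q W)" unfolding W_def by (intro countable_lin_span Q countable_image)
    show "lin_span Q W \<noteq> {}" using lin_span.zero by blast
  next
    have orbit: "\<exists>s. s 0 = y \<and> decaying_backward_orbit (T j) s" if "y \<in> W" for y
    proof -
      \<comment> \<open>The derivatives in direction \<open>j\<close> are collected in the power;
        those in other directions commute with \<open>T j\<close> and are absorbed into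
        \<open>g\<close> without leaving its kernel.\<close>
      have "\<exists>m g. g \<in> entire \<and> T j g = (\<lambda>z. 0) \<and> y = (ddir (axis j 1) ^^ m) g"
        using that
      proof (rule W_induct)
        show "\<exists>m g. g \<in> entire \<and> T j g = (\<lambda>z. 0) \<and> f = (ddir (axis j 1) ^^ m) g"
          by (intro exI[of _ 0] exI[of _ f]) (simp add: f)
      next
        fix y k
        assume "y \<in> W" "\<exists>m g. g \<in> entire \<and> T j g = (\<lambda>z. 0) \<and> y = (ddir (axis j 1) ^^ m) g"
        then obtain m g where g: "g \<in> entire" "T j g = (\<lambda>z. 0)" "y = (ddir (axis j 1) ^^ m) g" by blast
        have y: "pderiv_at k y = ddir (axis k 1) y" using \<open>y \<in> W\<close> We by (auto intro: pderiv_at_eq_ddir)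
        show "\<exists>m g. g \<in> entire \<and> T j g = (\<lambda>z. 0) \<and> pderiv_at k y = (ddir (axis j 1) ^^ m) g"
        proof (cases "k = j")
          case True
          then show ?thesis using g y by (intro exI[of _ "Suc m"] exI[of _ g]) simp
        next
          case False
          have "T j (pderiv_at k g) = (\<lambda>z. 0)"
            using False comm[OF g(1), of j k] by (simp add: g(2) pderiv_at_eq_ddir)
          moreover have "pderiv_at k y = (ddir (axis j 1) ^^ m) (pderiv_at k g)"
            using y by (simp only: g(3) ddir_funpow_commute[OF g(1)] pderiv_at_eq_ddir[OF g(1)])
          ultimately show ?thesis using pderiv_at_entire[OF g(1)] by blast
        qed
      qed
      then obtain m g where g: "g \<in> entire" "T j g = (\<lambda>z. 0)" "y = (ddir (axis j 1) ^^ m) g" by blast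
      have "T j (ddir (axis j 1) f) = (\<lambda>z. ddir (axis j 1) (T j f) z + a j * f z)" if "f \<in> entire" for f
        using comm[OF that, of j j] bounded_operator_entire[OF T that] that by (simp add: pderiv_at_eq_ddir)
      from ladder_backward_orbit[OF T assms(3) this g(1,2)] show ?thesis using g(3) by blast
    qed
    fix y assume "y \<in> lin_span Q W"
    then show "\<exists>s. s 0 = y \<and> decaying_backward_orbit (T j) s"
    proof induction
      case zero
      show ?case by (intro exI[of _ "\<lambda>q z. 0"] conjI refl decaying_backward_orbit_zero[OF T])
    next
      case (step p c y)
      obtain s where s: "s 0 = p" "decaying_backward_orbit (T j) s" using step.IH by blast
      obtain t where t: "t 0 = y" "decaying_backward_orbit (T j) t" using orbit[OF step.hyps(3)] by blast
      show ?case
        by (rule exI[of _ "\<lambda>q z. s q z + c * t q z"])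
          (simp add: s(1) t(1) decaying_backward_orbit_add_cmult[OF T s(2) t(2)])
    qed
  next
    fix g :: "complex ^ 'd \<Rightarrow> complex" and R e :: real assume "g \<in> entire" "e > 0"
    then have g: "g \<in> ?M" and e: "e / 2 > 0" using \<open>?M = entire\<close> by auto
    obtain p where p: "p \<in> lin_span UNIV W" "\<And>z. z \<in> cball 0 R \<Longrightarrow> cmod (p z - g z) < e / 2"
      by (rule entire_closureE[where R=R, OF g e]) blast
    obtain h where h: "h \<in> lin_span Q W" "\<forall>z\<in>cball 0 R. cmod (h z - p z) < e / 2"
      using lin_span_dense_coefficients[OF We p(1) e Q(2)] by blast
    have "cmod (h z - g z) < e" if "z \<in> cball 0 R" for z
      using norm_triangle_ineq[of "h z - p z" "p z - g z"] p(2)[OF that] h(2) that by fastforce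
    then show "\<exists>h\<in>lin_span Q W. \<forall>z\<in>cball 0 R. cmod (h z - g z) < e"
      by (intro bexI[OF _ h(1)] ballI)
  qed
qed

end
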